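(* Let $1\le p<\infty$, let $p'$ be the conjugate exponent ($\frac1p+\frac1{p'}=1$), and let $M\in L^{p}(\mathbb{T}^{2})$. Then the system $\{M(x,y)e^{ikx}e^{imy}:(k,m)\in\mathbb{Z}^2\setminus\{(0,0)\}\}$ is complete and minimal in $L^{p}(\mathbb{T}^{2})$ if and only if $$\int_{\mathbb{T}^{2}}|M(x,y)|^{-p'}\,dx\,dy=+\infty$$ and, for some $(x_0,y_0)\in\mathbb{T}^2$, $$\int_{\mathbb{T}^{2}}\left|\sin\frac{x-x_0}{2}\right|^{p'}|M(x,y)|^{-p'}\,dx\,dy<+\infty,\qquad \int_{\mathbb{T}^{2}}\left|\sin\frac{y-y_0}{2}\right|^{p'}|M(x,y)|^{-p'}\,dx\,dy<+\infty.$$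
   Context: $\mathbb{T}=\mathbb{R}/2\pi\mathbb{Z}$ with Lebesgue measure; functions are complex valued. A system in a Banach space is complete if its closed linear span is the whole space, and minimal if no element lies in the closed linear span of the others. Convention: $1/0=+\infty$. When $p=1$ (so $p'=\infty$), a condition $\int|F|^{p'}<+\infty$ (respectively $=+\infty$) is read as $F\in L^{\infty}$ (respectively $F\notin L^{\infty}$), where $F$ is $M^{-1}$, $\sin\frac{x-x_0}{2}\,M^{-1}$ or $\sin\frac{y-y_0}{2}\,M^{-1}$. *)

theory Defs
  imports "HOL-Analysis.Analysis" "HOL-Probability.Essential_Supremum"
begin

text \<open>
  The torus \<open>(\<real> / 2\<pi>\<int>)\<^sup>2\<close> is represented by the fundamental domain \<open>[0, 2\<pi>)\<^sup>2\<close>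
  with (completed) Lebesgue measure.
\<close>

definition circle_dom :: "real set" where
  "circle_dom = {0..<2 * pi}"

definition torus2 :: "(real \<times> real) measure" where
  "torus2 = lebesgue_on (circle_dom \<times> circle_dom)"

text \<open>
  Elements of \<open>L\<^sup>p\<close> are represented by functions, without passing to the quotient by equality
  almost everywhere. So \<^term>\<open>Lp_norm\<close> is a seminorm here; the notions below
  are invariant under changes on null sets.
\<close>

definition Lp_space :: "real \<Rightarrow> (real \<times> real \<Rightarrow> complex) set" where
  "Lp_space p = {f. f \<in> borel_measurable torus2 \<and> integrable torus2 (\<lambda>z. norm (f z) powr p)}"

definition Lp_norm :: "real \<Rightarrow> (real \<times> real \<Rightarrow> complex) \<Rightarrow> real" where
  "Lp_norm p f = (\<integral>z. norm (f z) powr p \<partial>torus2) powr (1 / p)"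

definition complex_span :: "(real \<times> real \<Rightarrow> complex) set \<Rightarrow> (real \<times> real \<Rightarrow> complex) set" where
  "complex_span S = {\<lambda>z. \<Sum>g\<in>A. c g * g z | A c. finite A \<and> A \<subseteq> S}"

text \<open>Closed linear span in \<open>L\<^sup>p\<close>; to be used with \<open>S \<subseteq> Lp_space p\<close> only, since the Bochner
  integral in \<^term>\<open>Lp_norm\<close> is \<open>0\<close> for non-integrable integrands.\<close>

definition Lp_closed_span ::
    "real \<Rightarrow> (real \<times> real \<Rightarrow> complex) set \<Rightarrow> (real \<times> real \<Rightarrow> complex) set" where
  "Lp_closed_span p S =
     {f \<in> Lp_space p. \<forall>\<epsilon>>0. \<exists>g\<in>complex_span S. Lp_norm p (\<lambda>z. f z - g z) < \<epsilon>}"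

definition Lp_complete_system ::
    "real \<Rightarrow> 'i set \<Rightarrow> ('i \<Rightarrow> real \<times> real \<Rightarrow> complex) \<Rightarrow> bool" where
  "Lp_complete_system p J \<phi> \<longleftrightarrow> Lp_closed_span p (\<phi> ` J) = Lp_space p"

definition Lp_minimal_system ::
    "real \<Rightarrow> 'i set \<Rightarrow> ('i \<Rightarrow> real \<times> real \<Rightarrow> complex) \<Rightarrow> bool" where
  "Lp_minimal_system p J \<phi> \<longleftrightarrow> (\<forall>j\<in>J. \<phi> j \<notin> Lp_closed_span p (\<phi> ` (J - {j})))"

definition weighted_exp ::
    "(real \<times> real \<Rightarrow> complex) \<Rightarrow> int \<times> int \<Rightarrow> real \<times> real \<Rightarrow> complex" where
  "weighted_exp M = (\<lambda>(k, m) (x, y).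
     M (x, y) * exp (\<i> * of_int k * of_real x) * exp (\<i> * of_int m * of_real y))"

text \<open>The convention \<open>1/0 = \<infinity>\<close> is the one of \<^typ>\<open>ennreal\<close>.\<close>

definition recip_modulus :: "(real \<times> real \<Rightarrow> complex) \<Rightarrow> real \<times> real \<Rightarrow> ennreal" where
  "recip_modulus M z = inverse (ennreal (norm (M z)))"

text \<open>Power of an extended nonnegative real with real exponent \<open>q > 0\<close>.\<close>

definition ennreal_powr :: "ennreal \<Rightarrow> real \<Rightarrow> ennreal" where
  "ennreal_powr a q = (if a = \<infinity> then \<infinity> else ennreal (enn2real a powr q))"

text \<open>
  For \<open>q < \<infinity>\<close> this is \<open>\<integral> F\<^sup>q\<close>. For \<open>q = \<infinity>\<close> it is the essential supremum of \<open>F\<close>, so that (for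
  measurable \<open>F\<close>) finiteness of \<open>power_integral q F\<close> means \<open>F \<in> L\<^sup>q\<close> in either case.
  A factor \<open>0 \<cdot> \<infinity> = 0\<close> in \<open>F = \<bar>sin ((x - x\<^sub>0) / 2)\<bar> \<cdot> \<bar>M\<bar>\<^sup>-\<^sup>1\<close> only occurs on a null set.
\<close>

definition power_integral :: "ennreal \<Rightarrow> (real \<times> real \<Rightarrow> ennreal) \<Rightarrow> ennreal" where
  "power_integral q F =
     (if q = \<infinity> then esssup torus2 F
      else (\<integral>\<^sup>+ z. ennreal_powr (F z) (enn2real q) \<partial>torus2))"

lemma weighted_exp_in_Lp_space:
  assumes "M \<in> Lp_space p"
  shows "weighted_exp M j \<in> Lp_space p"
proof -
  obtain k m where j: "j = (k, m)" by (cases j)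
  define e :: "real \<times> real \<Rightarrow> complex" where
    "e = (\<lambda>z. exp (\<i> * of_int k * of_real (fst z)) * exp (\<i> * of_int m * of_real (snd z)))"
  have eq: "weighted_exp M j = (\<lambda>z. M z * e z)"
    by (auto simp: weighted_exp_def j e_def fun_eq_iff)
  have "continuous_on UNIV e"
    unfolding e_def by (intro continuous_intros)
  then have "e \<in> borel_measurable borel"
    by (rule borel_measurable_continuous_onI)
  then have "e \<in> borel_measurable torus2"
    unfolding torus2_def
    by (intro measurable_restrict_space1 measurable_completion) simp
  moreover have "norm (e z) = 1" for z
    by (simp add: e_def norm_mult norm_exp_eq_Re)
  ultimately show ?thesis
    using assms by (auto simp: Lp_space_def eq norm_mult intro!: borel_measurable_times)
qed

end

theory Submission
  imports Defs "HOL-Library.Function_Algebras"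
begin

text \<open>
  Orthogonality of the characters suggests the criterion. If \<open>g\<close> annihilates
  \<open>M e\<^sub>j\<close> for every \<open>j \<noteq> 0\<close>, then all Fourier coefficients of \<open>M g\<close> but the zeroth vanish, so
  \<open>M g\<close> is a constant: the annihilator is trivial exactly when \<open>M \<noteq> 0\<close> almost everywhere and
  \<open>1/M\<close> is not in \<open>L\<^sup>p\<^sup>'\<close>. A functional that is biorthogonal to \<open>M e\<^sub>j\<close> is a multiple of
  \<open>(e\<^sub>-\<^sub>j - d) / M\<close> for some constant \<open>d\<close>. When \<open>1/M\<close> is not in \<open>L\<^sup>p\<^sup>'\<close>, the numerator cannot stay
  away from \<open>0\<close>, so \<open>\<bar>d\<bar> = 1\<close>; for \<open>j = (1, 0)\<close> this means \<open>d = exp (- i x\<^sub>0)\<close> and the modulus of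
  the numerator is \<open>2 \<bar>sin ((x - x\<^sub>0) / 2)\<bar>\<close>. Conversely \<open>e\<^sub>-\<^sub>j - e\<^sub>-\<^sub>j(x\<^sub>0, y\<^sub>0)\<close> is dominated by the two
  sines, so the two sine conditions yield all biorthogonal functionals.

  The proof makes this rigorous without the dual space of \<open>L\<^sup>p\<close>. Only functionals of the form
  \<open>M P \<mapsto> \<integral> P u\<close> on trigonometric polynomials \<open>P\<close> matter, with \<open>u\<close> a bounded function, and for them
  boundedness in the \<open>L\<^sup>p\<close> seminorm is equivalent to \<open>u / M \<in> L\<^sup>p\<^sup>'\<close> when \<open>M \<noteq> 0\<close> almost everywhere:

  \<^item> If the functional is bounded, the estimate extends from trigonometric polynomials to all bounded
    measurable \<open>P\<close> (\<open>integral_bound_extends\<close>), and testing it on a truncation of the extremal function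
    of Hoelder's inequality bounds the integral of \<open>\<bar>u / M\<bar>\<^sup>p\<^sup>'\<close> (\<open>power_integral_finite_if_bound\<close>).
  \<^item> The converse is Hoelder's inequality up to a constant (\<open>quotient_functional_bounded\<close>).

  Bounded functionals come from distances: if \<open>M e\<^sub>j\<close> is at positive distance from the span of the
  other exponentials, then the \<open>j\<close>-th coefficient is bounded on the polynomials concerned
  (\<open>coefficient_bounded_if_not_in_closed_span\<close>). For \<open>j = 0\<close> and \<open>u = 1\<close> this gives completeness. For
  minimality the \<open>j\<close>-th coefficient is at first controlled only on polynomials without constant term;
  completeness, which approximates \<open>M\<close> by such polynomials, extends the control to all polynomials at
  the price of the constant \<open>d\<close> (\<open>shifted_character_bound\<close>).
\<close>

section \<open>Complex spans of functions\<close>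

text \<open>
  Complex-valued functions as a complex vector space, which makes the general theory of spans
  available for \<^const>\<open>complex_span\<close>.
\<close>

interpretation pointwise: vector_space "\<lambda>(c::complex) (f::real \<times> real \<Rightarrow> complex) z. c * f z"
  by unfold_locales (auto simp: fun_eq_iff algebra_simps)

lemma sum_fun_apply:
  fixes f :: "'i \<Rightarrow> 'a \<Rightarrow> 'b::comm_monoid_add"
  shows "(\<Sum>i\<in>A. f i) z = (\<Sum>i\<in>A. f i z)"
  by (induction A rule: infinite_finite_induct) auto

lemma complex_span_eq_span: "complex_span S = pointwise.span S"
  unfolding complex_span_def pointwise.span_explicit
  by (intro Collect_cong ex_cong1 conj_cong refl) (auto simp: fun_eq_iff sum_fun_apply)

lemma complex_span_base: "f \<in> S \<Longrightarrow> f \<in> complex_span S"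
  by (simp add: complex_span_eq_span pointwise.span_base)

lemma complex_span_mono: "S \<subseteq> T \<Longrightarrow> complex_span S \<subseteq> complex_span T"
  by (simp add: complex_span_eq_span pointwise.span_mono)

lemma complex_span_add:
  "f \<in> complex_span S \<Longrightarrow> g \<in> complex_span S \<Longrightarrow> (\<lambda>z. f z + g z) \<in> complex_span S"
  using pointwise.span_add[of f S g] by (simp add: complex_span_eq_span plus_fun_def)

lemma complex_span_diff:
  "f \<in> complex_span S \<Longrightarrow> g \<in> complex_span S \<Longrightarrow> (\<lambda>z. f z - g z) \<in> complex_span S"
  using pointwise.span_diff[of f S g] by (simp add: complex_span_eq_span fun_diff_def)

lemma complex_span_scale:
  "f \<in> complex_span S \<Longrightarrow> (\<lambda>z. c * f z) \<in> complex_span S"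
  using pointwise.span_scale[of f S c] by (simp add: complex_span_eq_span)

lemma complex_span_induct [consumes 1, case_names base zero add scale]:
  assumes "f \<in> complex_span S" "\<And>g. g \<in> S \<Longrightarrow> P g" "P (\<lambda>_. 0)"
    "\<And>f g. P f \<Longrightarrow> P g \<Longrightarrow> P (\<lambda>z. f z + g z)" "\<And>c f. P f \<Longrightarrow> P (\<lambda>z. c * f z)"
  shows "P f"
proof -
  have "f \<in> pointwise.span S" using assms(1) by (simp add: complex_span_eq_span)
  then show ?thesis
  proof (rule pointwise.span_induct)
    show "pointwise.subspace (Collect P)"
      using assms by (auto simp: pointwise.subspace_def zero_fun_def plus_fun_def)
  qed (use assms(2) in auto)
qed

lemma complex_span_insert:
  assumes "f \<in> complex_span (insert g S)"
  obtains c where "(\<lambda>z. f z - c * g z) \<in> complex_span S"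
  using assms by (auto simp: complex_span_eq_span pointwise.span_insert fun_diff_def)

section \<open>Trigonometric polynomials\<close>

abbreviation character :: "int \<times> int \<Rightarrow> real \<times> real \<Rightarrow> complex" where
  "character \<equiv> weighted_exp (\<lambda>_. 1)"

definition trig_poly :: "(int \<times> int) set \<Rightarrow> (real \<times> real \<Rightarrow> complex) set" where
  "trig_poly J = complex_span (character ` J)"

lemma character_altdef:
  "character j z = exp (\<i> * (of_int (fst j) * of_real (fst z) + of_int (snd j) * of_real (snd z)))"
  by (cases j; cases z) (simp add: weighted_exp_def exp_add distrib_left mult.assoc)

lemma character_zero: "character (0, 0) = (\<lambda>_. 1)"
  by (simp add: character_altdef fun_eq_iff)

lemma character_mult: "character j z * character l z = character (j + l) z"
  by (simp add: character_altdef algebra_simps flip: exp_add)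

lemma norm_character [simp]: "norm (character j z) = 1"
  by (simp add: character_altdef norm_exp_eq_Re)

lemma weighted_exp_eq: "weighted_exp M j = (\<lambda>z. M z * character j z)"
  by (cases j) (auto simp: weighted_exp_def fun_eq_iff)

text \<open>
  Multiplication by \<open>M\<close> is linear, so it carries the span of the characters onto the span of the
  weighted exponentials. From here on the system is represented by the products \<open>M P\<close> with
  trigonometric polynomials \<open>P\<close>, even when different indices give the same function.
\<close>

lemma weighted_span_eq:
  "complex_span (weighted_exp M ` J) = (\<lambda>P z. M z * P z) ` trig_poly J"
proof -
  interpret module_hom "\<lambda>(c::complex) (f::real \<times> real \<Rightarrow> complex) z. c * f z"
    "\<lambda>(c::complex) (f::real \<times> real \<Rightarrow> complex) z. c * f z" "\<lambda>P z. M z * P z"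
    by unfold_locales (auto simp: fun_eq_iff algebra_simps)
  have "weighted_exp M ` J = (\<lambda>P z. M z * P z) ` character ` J"
    unfolding image_image weighted_exp_eq[of M] ..
  then show ?thesis
    by (simp add: complex_span_eq_span trig_poly_def span_image)
qed

lemma trig_poly_character: "j \<in> J \<Longrightarrow> character j \<in> trig_poly J"
  unfolding trig_poly_def by (intro complex_span_base) auto

lemma trig_poly_const: "(\<lambda>_. c) \<in> trig_poly UNIV"
  using complex_span_scale[OF trig_poly_character[of "(0,0)" UNIV, unfolded trig_poly_def], of c]
  by (simp add: character_zero trig_poly_def)

lemma trig_poly_add:
  "P \<in> trig_poly J \<Longrightarrow> Q \<in> trig_poly J \<Longrightarrow> (\<lambda>z. P z + Q z) \<in> trig_poly J"
  unfolding trig_poly_def by (rule complex_span_add)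

lemma trig_poly_diff:
  "P \<in> trig_poly J \<Longrightarrow> Q \<in> trig_poly J \<Longrightarrow> (\<lambda>z. P z - Q z) \<in> trig_poly J"
  unfolding trig_poly_def by (rule complex_span_diff)

lemma trig_poly_scale:
  "P \<in> trig_poly J \<Longrightarrow> (\<lambda>z. c * P z) \<in> trig_poly J"
  unfolding trig_poly_def by (rule complex_span_scale)

lemma trig_poly_mono: "J \<subseteq> J' \<Longrightarrow> trig_poly J \<subseteq> trig_poly J'"
  unfolding trig_poly_def by (intro complex_span_mono image_mono)

lemma continuous_on_character: "continuous_on A (character j)"
proof -
  have "character j = (\<lambda>z. exp (\<i> * (of_int (fst j) * of_real (fst z) + of_int (snd j) * of_real (snd z))))"
    by (simp add: fun_eq_iff character_altdef)
  then show ?thesis by (simp only:) (intro continuous_intros)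
qed

lemma trig_poly_mult:
  assumes "P \<in> trig_poly UNIV" "Q \<in> trig_poly UNIV"
  shows "(\<lambda>z. P z * Q z) \<in> trig_poly UNIV"
proof -
  have *: "(\<lambda>z. character j z * Q z) \<in> trig_poly UNIV" for j
    using assms(2) unfolding trig_poly_def
  proof (induction rule: complex_span_induct)
    case (base g)
    then obtain l where "g = character l" by auto
    then show ?case by (simp add: character_mult complex_span_base)
  next
    case zero
    then show ?case by (simp add: complex_span_eq_span pointwise.span_zero[unfolded zero_fun_def])
  next
    case (add f g)
    from complex_span_add[OF this] show ?case by (simp add: algebra_simps)
  next
    case (scale c f)
    from complex_span_scale[OF this, of c] show ?case by (simp add: algebra_simps)
  qed
  show ?thesis
    using assms(1) unfolding trig_poly_def
  proof (induction rule: complex_span_induct)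
    case (base g)
    then obtain l where "g = character l" by auto
    then show ?case using *[of l] by (simp add: trig_poly_def)
  next
    case zero
    then show ?case by (simp add: complex_span_eq_span pointwise.span_zero[unfolded zero_fun_def])
  next
    case (add f g)
    from complex_span_add[OF this] show ?case by (simp add: algebra_simps)
  next
    case (scale c f)
    from complex_span_scale[OF this, of c] show ?case by (simp add: algebra_simps)
  qed
qed

lemma trig_poly_continuous:
  assumes "P \<in> trig_poly J" shows "continuous_on A P"
  using assms unfolding trig_poly_def
  by (induction rule: complex_span_induct) (auto intro!: continuous_intros continuous_on_character)

lemma trig_poly_bounded:
  assumes "P \<in> trig_poly J" obtains B where "\<And>z. norm (P z) \<le> B"
proof -
  have "\<exists>B. \<forall>z. norm (P z) \<le> B"
    using assms unfolding trig_poly_def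
  proof (induction rule: complex_span_induct)
    case (base g)
    then show ?case by (intro exI[of _ 1]) auto
  next
    case (add f g)
    then obtain B C where "\<forall>z. norm (f z) \<le> B" "\<forall>z. norm (g z) \<le> C" by blast
    then show ?case by (intro exI[of _ "B + C"]) (auto intro!: norm_triangle_mono)
  next
    case (scale c f)
    then obtain B where "\<forall>z. norm (f z) \<le> B" by blast
    then show ?case by (intro exI[of _ "norm c * B"]) (auto simp: norm_mult intro!: mult_left_mono)
  qed auto
  then show ?thesis using that by blast
qed

section \<open>Integration over the torus\<close>

lemma circle_dom_sets [measurable]: "circle_dom \<in> sets borel"
  by (simp add: circle_dom_def)

lemma torus2_dom_lmeasurable: "circle_dom \<times> circle_dom \<in> sets lebesgue"
  by (intro sets_completionI_sets) (simp add: borel_prod[symmetric] del: borel_prod)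

lemma space_torus2: "space torus2 = circle_dom \<times> circle_dom"
  by (simp add: torus2_def space_restrict_space)

lemma continuous_imp_measurable_torus2:
  fixes f :: "real \<times> real \<Rightarrow> 'b::topological_space"
  shows "continuous_on UNIV f \<Longrightarrow> f \<in> borel_measurable torus2"
  unfolding torus2_def
  by (intro measurable_restrict_space1 measurable_completion)
     (simp add: borel_measurable_continuous_onI)

lemma emeasure_torus2: "emeasure torus2 (space torus2) = ennreal (4 * pi\<^sup>2)"
proof -
  have "emeasure torus2 (space torus2) = emeasure lborel (circle_dom \<times> circle_dom)"
    using torus2_dom_lmeasurable
    by (subst space_torus2, unfold torus2_def)
       (simp add: emeasure_restrict_space emeasure_completion borel_prod[symmetric] del: borel_prod)
  also have "\<dots> = emeasure (lborel \<Otimes>\<^sub>M lborel) (circle_dom \<times> circle_dom)"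
    by (simp add: lborel_prod)
  also have "\<dots> = emeasure lborel circle_dom * emeasure lborel circle_dom"
    by (rule lborel.emeasure_pair_measure_Times) auto
  also have "\<dots> = ennreal (4 * pi\<^sup>2)"
    by (simp add: circle_dom_def ennreal_mult'[symmetric] power2_eq_square)
  finally show ?thesis .
qed

interpretation torus2: finite_measure torus2
  by standard (simp add: emeasure_torus2)

lemma torus2_integrable_bounded:
  fixes f :: "real \<times> real \<Rightarrow> 'b::{banach, second_countable_topology}"
  assumes "f \<in> borel_measurable torus2" "\<And>z. norm (f z) \<le> B"
  shows "integrable torus2 f"
  using assms by (intro torus2.integrable_const_bound[where B = B]) auto

text \<open>
  The half-open interval differs from the closed one, where the fundamental theorem of calculus
  applies, by a null set.
\<close>

lemma integral_exp_circle:
  "(\<integral>x\<in>circle_dom. exp (\<i> * (of_int k * of_real x)) \<partial>lborel) = (if k = 0 then 2 * pi else 0)"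
proof (cases "k = 0")
  case True
  then show ?thesis by (simp add: circle_dom_def set_lebesgue_integral_def scaleR_conv_of_real)
next
  case False
  define F where "F = (\<lambda>x::real. exp (\<i> * (of_int k * of_real x)) / (\<i> * of_int k))"
  have "(\<integral>x. indicator {0..2*pi} x *\<^sub>R exp (\<i> * (of_int k * of_real x)) \<partial>lborel) = F (2*pi) - F 0"
  proof (rule integral_FTC_atLeastAtMost)
    show "(F has_vector_derivative exp (\<i> * (of_int k * of_real x))) (at x within {0..2 * pi})" for x
      unfolding F_def using False
      by (auto intro!: derivative_eq_intros has_vector_derivative_real_field simp: field_simps)
  qed (auto intro!: continuous_intros)
  also have "exp (\<i> * (of_int k * of_real (2 * pi))) = (1::complex)"
    using exp_integer_2pi[of "of_int k"] by (simp add: mult_ac)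
  then have "F (2*pi) - F 0 = 0" by (simp add: F_def)
  finally have "(\<integral>x. indicator {0..2*pi} x *\<^sub>R exp (\<i> * (of_int k * of_real x)) \<partial>lborel) = (0::complex)" .
  moreover have "(\<integral>x. indicator {0..2*pi} x *\<^sub>R exp (\<i> * (of_int k * of_real x)) \<partial>lborel)
    = (\<integral>x. indicator circle_dom x *\<^sub>R (exp (\<i> * (of_int k * of_real x)) :: complex) \<partial>lborel)"
    by (rule integral_cong_AE)
       (auto simp: circle_dom_def indicator_def intro!: AE_I[where N = "{2*pi}"])
  ultimately show ?thesis using False by (simp add: set_lebesgue_integral_def)
qed

lemma integral_character:
  "(\<integral>z. character j z \<partial>torus2) = (if j = (0, 0) then 4 * pi\<^sup>2 else 0)"
proof -
  obtain k m where j: "j = (k, m)" by (cases j)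
  define E where "E = (\<lambda>(k::int) x. indicator circle_dom x *\<^sub>R exp (\<i> * (of_int k * of_real x)) :: complex)"
  have E: "integrable lborel (E k)" for k
  proof -
    have "integrable lborel (\<lambda>x. indicator {0..2*pi} x *\<^sub>R exp (\<i> * (of_int k * of_real x)) :: complex)"
      by (intro borel_integrable_compact continuous_intros) auto
    then show ?thesis unfolding E_def
      by (rule Bochner_Integration.integrable_bound)
         (auto simp: circle_dom_def indicator_def)
  qed
  have "(\<integral>z. character j z \<partial>torus2)
      = (\<integral>z. indicator (circle_dom \<times> circle_dom) z *\<^sub>R character j z \<partial>lebesgue)"
    unfolding torus2_def using torus2_dom_lmeasurable
    by (simp add: integral_restrict_space)
  also have "\<dots> = (\<integral>z. E k (fst z) * E m (snd z) \<partial>lebesgue)"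
    by (intro Bochner_Integration.integral_cong)
       (auto simp: E_def j character_altdef indicator_def exp_add distrib_left)
  also have "\<dots> = (\<integral>z. E k (fst z) * E m (snd z) \<partial>(lborel \<Otimes>\<^sub>M lborel))"
    unfolding lborel_prod by (rule integral_completion) (simp add: E_def borel_prod[symmetric] del: borel_prod)
  also have "\<dots> = (\<integral>x. E k x \<partial>lborel) * (\<integral>x. E m x \<partial>lborel)"
  proof -
    have [measurable]: "(\<lambda>z. E k (fst z) * E m (snd z)) \<in> borel_measurable (lborel \<Otimes>\<^sub>M lborel)"
      unfolding E_def by measurable
    have "integrable (lborel \<Otimes>\<^sub>M lborel) (\<lambda>z. E k (fst z) * E m (snd z))"
      by (rule lborel_pair.Fubini_integrable)
         (use E[of k] E[of m] in \<open>auto simp: norm_mult\<close>)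
    from lborel_pair.integral_fst'[OF this] show ?thesis by simp
  qed
  also have "\<dots> = (if j = (0, 0) then 4 * pi\<^sup>2 else 0)"
    using integral_exp_circle[of k] integral_exp_circle[of m]
    by (auto simp: E_def j set_lebesgue_integral_def power2_eq_square)
  finally show ?thesis .
qed

section \<open>The space of p-integrable functions\<close>

lemma Lp_space_measurable: "f \<in> Lp_space p \<Longrightarrow> f \<in> borel_measurable torus2"
  by (simp add: Lp_space_def)

text \<open>
  The dominating function is given as \<open>w\<close> with \<open>w\<^sup>p\<close> integrable, so that it can be a multiple of the
  modulus of an \<open>L\<^sup>p\<close> function.
\<close>

lemma Lp_space_dominated:
  assumes "g \<in> borel_measurable torus2" "integrable torus2 (\<lambda>z. w z powr p)" "0 \<le> p"
    and "AE z in torus2. norm (g z) \<le> w z"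
  shows "g \<in> Lp_space p"
proof -
  have "integrable torus2 (\<lambda>z. norm (g z) powr p)"
  proof (rule Bochner_Integration.integrable_bound[OF assms(2)])
    show "AE z in torus2. norm (norm (g z) powr p) \<le> norm (w z powr p)"
      using assms(4) by eventually_elim (auto intro!: powr_mono2 assms)
  qed (use assms(1) in measurable)
  then show ?thesis using assms(1) by (simp add: Lp_space_def)
qed

lemma Lp_norm_nonneg [simp]: "0 \<le> Lp_norm p f"
  by (simp add: Lp_norm_def)

lemma Lp_norm_powr:
  assumes "1 \<le> p"
  shows "Lp_norm p f powr p = (\<integral>z. norm (f z) powr p \<partial>torus2)"
  using assms by (simp add: Lp_norm_def powr_powr)

lemma Lp_space_mult_bounded:
  assumes "1 \<le> p" "f \<in> Lp_space p" "u \<in> borel_measurable torus2" "\<And>z. z \<in> space torus2 \<Longrightarrow> norm (u z) \<le> B"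
  shows "(\<lambda>z. f z * u z) \<in> Lp_space p"
proof (rule Lp_space_dominated[where w = "\<lambda>z. \<bar>B\<bar> * norm (f z)"])
  show "integrable torus2 (\<lambda>z. (\<bar>B\<bar> * norm (f z)) powr p)"
    using assms by (simp add: powr_mult Lp_space_def)
  show "AE z in torus2. norm (f z * u z) \<le> \<bar>B\<bar> * norm (f z)"
  proof (rule AE_I2)
    fix z assume "z \<in> space torus2"
    from assms(4)[OF this] show "norm (f z * u z) \<le> \<bar>B\<bar> * norm (f z)"
      by (subst mult.commute) (auto simp: norm_mult intro!: mult_right_mono)
  qed
  show "(\<lambda>z. f z * u z) \<in> borel_measurable torus2"
    using assms(2,3) by (auto simp: Lp_space_def)
qed (use assms in auto)

lemma Lp_space_scale:
  assumes "1 \<le> p" "f \<in> Lp_space p" shows "(\<lambda>z. c * f z) \<in> Lp_space p"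
  using Lp_space_mult_bounded[OF assms, of "\<lambda>_. c" "norm c"] by (simp add: mult.commute)

lemma Lp_norm_scale:
  assumes "1 \<le> p" shows "Lp_norm p (\<lambda>z. c * f z) = norm c * Lp_norm p f"
  using assms by (simp add: Lp_norm_def norm_mult powr_mult powr_powr)

lemma norm_add_powr_le:
  fixes a b :: "'a::real_normed_vector"
  assumes "0 \<le> p"
  shows "norm (a + b) powr p \<le> 2 powr p * (norm a powr p + norm b powr p)"
proof -
  have "norm (a + b) powr p \<le> (2 * max (norm a) (norm b)) powr p"
    using assms norm_triangle_ineq[of a b] by (intro powr_mono2) auto
  also have "\<dots> = 2 powr p * max (norm a) (norm b) powr p"
    by (simp add: powr_mult)
  also have "\<dots> \<le> 2 powr p * (norm a powr p + norm b powr p)"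
    by (intro mult_left_mono) (auto simp: max_def)
  finally show ?thesis .
qed

lemma Lp_space_add:
  assumes "1 \<le> p" "f \<in> Lp_space p" "g \<in> Lp_space p"
  shows "(\<lambda>z. f z + g z) \<in> Lp_space p"
proof -
  have m [measurable]: "f \<in> borel_measurable torus2" "g \<in> borel_measurable torus2"
    using assms by (auto simp: Lp_space_def)
  have "integrable torus2 (\<lambda>z. 2 powr p * (norm (f z) powr p + norm (g z) powr p))"
    using assms by (auto simp: Lp_space_def)
  then have "integrable torus2 (\<lambda>z. norm (f z + g z) powr p)"
    by (rule Bochner_Integration.integrable_bound)
       (use assms norm_add_powr_le[of p "f _" "g _"] in auto)
  then show ?thesis by (simp add: Lp_space_def)
qed

lemma Lp_space_diff:
  assumes "1 \<le> p" "f \<in> Lp_space p" "g \<in> Lp_space p"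
  shows "(\<lambda>z. f z - g z) \<in> Lp_space p"
  using Lp_space_add[OF assms(1,2) Lp_space_scale[OF assms(1,3), of "-1"]] by simp

text \<open>
  Minkowski's inequality up to a factor, from \<open>\<bar>a + b\<bar> \<le> 2 max \<bar>a\<bar> \<bar>b\<bar>\<close>. It serves only to show that norms
  are small and functionals are bounded, and neither depends on the constant.
\<close>

lemma Lp_norm_add_le:
  assumes "1 \<le> p" "f \<in> Lp_space p" "g \<in> Lp_space p"
  shows "Lp_norm p (\<lambda>z. f z + g z) \<le> 4 * (Lp_norm p f + Lp_norm p g)"
proof -
  define A B where "A = Lp_norm p f" and "B = Lp_norm p g"
  have AB: "0 \<le> A" "0 \<le> B" by (auto simp: A_def B_def)
  have "(\<integral>z. norm (f z + g z) powr p \<partial>torus2) \<le> (\<integral>z. 2 powr p * (norm (f z) powr p + norm (g z) powr p) \<partial>torus2)"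
    using assms Lp_space_add[OF assms] norm_add_powr_le[of p "f _" "g _"]
    by (intro integral_mono) (auto simp: Lp_space_def)
  also have "\<dots> = 2 powr p * (A powr p + B powr p)"
    using assms by (simp add: Lp_space_def A_def B_def Lp_norm_powr)
  also have "\<dots> \<le> 2 powr p * (2 powr p * max A B powr p)"
  proof (intro mult_left_mono)
    have "A powr p + B powr p \<le> 2 * max A B powr p"
      using AB assms by (auto simp: max_def intro!: powr_mono2)
    also have "2 * max A B powr p \<le> 2 powr p * max A B powr p"
      using powr_mono[of 1 p 2] assms by (intro mult_right_mono) auto
    finally show "A powr p + B powr p \<le> 2 powr p * max A B powr p" .
  qed auto
  also have "\<dots> = (4 * max A B) powr p"
    using AB by (simp add: powr_mult[symmetric])
  finally have "Lp_norm p (\<lambda>z. f z + g z) \<le> ((4 * max A B) powr p) powr (1 / p)"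
    unfolding Lp_norm_def using assms by (intro powr_mono2) auto
  also have "\<dots> = 4 * max A B" using assms AB by (simp add: powr_powr)
  finally show ?thesis using AB unfolding A_def[symmetric] B_def[symmetric] by (simp add: max_def split: if_splits)
qed

lemma Lp_norm_diff_le:
  assumes "1 \<le> p" "f \<in> Lp_space p" "g \<in> Lp_space p"
  shows "Lp_norm p (\<lambda>z. f z - g z) \<le> 4 * (Lp_norm p f + Lp_norm p g)"
  using Lp_norm_add_le[OF assms(1,2) Lp_space_scale[OF assms(1,3), of "-1"]]
    Lp_norm_scale[OF assms(1), of "-1" g] by simp

text \<open>
  Dominated convergence. Applied to differences that tend to \<open>0\<close> it gives convergence in \<open>L\<^sup>p\<close>.
\<close>

lemma Lp_norm_tendsto:
  assumes "1 \<le> p" "\<And>n. g n \<in> borel_measurable torus2" "g' \<in> borel_measurable torus2"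
    and "integrable torus2 (\<lambda>z. w z powr p)"
    and "\<And>n. AE z in torus2. norm (g n z) \<le> w z"
    and "AE z in torus2. (\<lambda>n. g n z) \<longlonglongrightarrow> g' z"
  shows "(\<lambda>n. Lp_norm p (g n)) \<longlonglongrightarrow> Lp_norm p g'"
proof -
  have "(\<lambda>n. \<integral>z. norm (g n z) powr p \<partial>torus2) \<longlonglongrightarrow> (\<integral>z. norm (g' z) powr p \<partial>torus2)"
  proof (rule integral_dominated_convergence[OF _ _ assms(4)])
    show "AE z in torus2. (\<lambda>n. norm (g n z) powr p) \<longlonglongrightarrow> norm (g' z) powr p"
      using assms(6) by eventually_elim (use assms(1) in \<open>auto intro!: tendsto_powr' tendsto_norm\<close>)
    show "AE z in torus2. norm (norm (g n z) powr p) \<le> w z powr p" for n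
      using assms(5)[of n] by eventually_elim (use assms(1) in \<open>auto intro!: powr_mono2\<close>)
  qed (use assms(2,3) in measurable)
  then show ?thesis
    unfolding Lp_norm_def using assms(1) by (intro tendsto_powr') auto
qed

lemma Lp_norm_diff_tendsto_0:
  assumes "1 \<le> p" "\<And>n. g n \<in> borel_measurable torus2" "g' \<in> borel_measurable torus2"
    and w: "integrable torus2 (\<lambda>z. w z powr p)" "\<And>z. 0 \<le> w z"
    and b: "\<And>n. AE z in torus2. norm (g n z) \<le> w z"
    and l: "AE z in torus2. (\<lambda>n. g n z) \<longlonglongrightarrow> g' z"
  shows "(\<lambda>n. Lp_norm p (\<lambda>z. g' z - g n z)) \<longlonglongrightarrow> 0"
proof -
  have "AE z in torus2. \<forall>n. norm (g n z) \<le> w z" using b by (simp add: AE_all_countable)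
  with l have b': "AE z in torus2. norm (g' z) \<le> w z"
    by eventually_elim (rule LIMSEQ_le_const2[OF tendsto_norm], auto)
  have "(\<lambda>n. Lp_norm p (\<lambda>z. g' z - g n z)) \<longlonglongrightarrow> Lp_norm p (\<lambda>_. 0)"
  proof (rule Lp_norm_tendsto)
    show "integrable torus2 (\<lambda>z. (2 * w z) powr p)" using w by (simp add: powr_mult)
    show "AE z in torus2. norm (g' z - g n z) \<le> 2 * w z" for n
      using b' b[of n] by eventually_elim (use norm_triangle_ineq4[of "g' _" "g n _"] in \<open>smt (verit)\<close>)
    show "AE z in torus2. (\<lambda>n. g' z - g n z) \<longlonglongrightarrow> 0"
      using l by eventually_elim (auto intro!: tendsto_eq_intros)
  qed (use assms in auto)
  then show ?thesis using assms(1) by (simp add: Lp_norm_def)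
qed

section \<open>Density of trigonometric polynomials\<close>

text \<open>
  The torus as a compact subset of \<open>\<complex>\<^sup>2\<close>, where ordinary polynomials restrict to
  trigonometric polynomials and the Weierstrass theorem applies.
\<close>

definition torus_embedding :: "real \<times> real \<Rightarrow> complex \<times> complex" where
  "torus_embedding z = (cis (fst z), cis (snd z))"

lemma continuous_on_torus_embedding: "continuous_on A torus_embedding"
  unfolding torus_embedding_def cis_conv_exp by (intro continuous_intros)

lemma trig_poly_cis:
  "(\<lambda>z. cis (fst z)) \<in> trig_poly UNIV" "(\<lambda>z. cnj (cis (fst z))) \<in> trig_poly UNIV"
  "(\<lambda>z. cis (snd z)) \<in> trig_poly UNIV" "(\<lambda>z. cnj (cis (snd z))) \<in> trig_poly UNIV"
  using trig_poly_character[of "(1,0)" UNIV] trig_poly_character[of "(-1,0)" UNIV]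
    trig_poly_character[of "(0,1)" UNIV] trig_poly_character[of "(0,-1)" UNIV]
  by (simp_all add: character_altdef[abs_def] cis_conv_exp exp_cnj)

lemma of_real_Re_Im: "of_real (Re w) = 1/2 * (w + cnj w)" "of_real (Im w) = - \<i>/2 * (w - cnj w)"
  by (auto simp: complex_eq_iff)

text \<open>
  A real-linear form on \<open>\<complex>\<^sup>2\<close> is a combination of real and imaginary parts of the coordinates, which
  become combinations of \<open>exp (\<plusminus> i x)\<close> and \<open>exp (\<plusminus> i y)\<close>. Sums and products are inherited.
\<close>

lemma real_polynomial_comp_embedding:
  assumes "real_polynomial_function g"
  shows "(\<lambda>z. complex_of_real (g (torus_embedding z))) \<in> trig_poly UNIV"
  using assms
proof (induction rule: real_polynomial_function.induct)
  case (linear g)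
  interpret g: bounded_linear g by fact
  have eq: "g (v, w) = Re v * g (1, 0) + Im v * g (\<i>, 0) + Re w * g (0, 1) + Im w * g (0, \<i>)" for v w
  proof -
    have "(v, w) = Re v *\<^sub>R (1, 0) + Im v *\<^sub>R (\<i>, 0) + Re w *\<^sub>R (0, 1) + Im w *\<^sub>R (0, \<i>)"
      by (simp add: complex_eq_iff)
    then have "g (v, w) = g (Re v *\<^sub>R (1, 0) + Im v *\<^sub>R (\<i>, 0) + Re w *\<^sub>R (0, 1) + Im w *\<^sub>R (0, \<i>))"
      by (rule arg_cong)
    then show ?thesis unfolding g.add g.scaleR by simp
  qed
  have "(\<lambda>z. complex_of_real (Re (cis (fst z)))) \<in> trig_poly UNIV" "(\<lambda>z. complex_of_real (Im (cis (fst z)))) \<in> trig_poly UNIV"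
    "(\<lambda>z. complex_of_real (Re (cis (snd z)))) \<in> trig_poly UNIV" "(\<lambda>z. complex_of_real (Im (cis (snd z)))) \<in> trig_poly UNIV"
    unfolding of_real_Re_Im
    by (intro trig_poly_scale trig_poly_add trig_poly_diff trig_poly_cis)+
  then have "(\<lambda>z. complex_of_real (Re (cis (fst z)) * g (1, 0) + Im (cis (fst z)) * g (\<i>, 0)
      + Re (cis (snd z)) * g (0, 1) + Im (cis (snd z)) * g (0, \<i>))) \<in> trig_poly UNIV"
    unfolding of_real_add of_real_mult
    by (intro trig_poly_add trig_poly_mult trig_poly_const)
  then show ?case
    unfolding torus_embedding_def eq[of "cis (fst _)"] .
next
  case (add f g)
  then show ?case using trig_poly_add by simp
next
  case (mult f g)
  then show ?case using trig_poly_mult by simp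
qed (simp add: trig_poly_const)

lemma polynomial_comp_embedding:
  fixes g :: "complex \<times> complex \<Rightarrow> complex"
  assumes "polynomial_function g"
  shows "(\<lambda>z. g (torus_embedding z)) \<in> trig_poly UNIV"
proof -
  have "real_polynomial_function (\<lambda>z. Re (g z))" "real_polynomial_function (\<lambda>z. Im (g z))"
    using assms bounded_linear_Re bounded_linear_Im by (auto simp: polynomial_function_def o_def)
  then have "(\<lambda>z. complex_of_real (Re (g (torus_embedding z))) + \<i> * complex_of_real (Im (g (torus_embedding z)))) \<in> trig_poly UNIV"
    by (intro trig_poly_add trig_poly_scale real_polynomial_comp_embedding)
  then show ?thesis by (simp flip: complex_eq)
qed

text \<open>
  On the closed interval \<open>[0, 2\<pi>]\<close> only the two end points are identified on the circle.
\<close>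

lemma cis_eq_imp:
  assumes "cis a = cis b" "a \<in> {0..2*pi}" "b \<in> {0..2*pi}"
  shows "a = b \<or> (a \<in> {0, 2*pi} \<and> b \<in> {0, 2*pi})"
proof -
  have "exp (\<i> * complex_of_real a) = exp (\<i> * complex_of_real b)"
    using assms(1) by (simp add: cis_conv_exp)
  then obtain n :: int where "\<i> * complex_of_real a = \<i> * complex_of_real b + (of_int (2 * n) * pi) * \<i>"
    by (auto simp: exp_eq)
  then have "Im (\<i> * complex_of_real a) = Im (\<i> * complex_of_real b + (of_int (2 * n) * pi) * \<i>)"
    by (rule arg_cong)
  then have n: "a = b + of_int n * (2 * pi)" by simp
  consider "n = 0" | "n \<ge> 1" | "n \<le> -1" by linarith
  then show ?thesis
  proof cases
    case 2
    then have "1 * (2 * pi) \<le> of_int n * (2 * pi)" by (intro mult_right_mono) auto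
    with n assms(2,3) have "b = 0 \<and> a = 2 * pi" unfolding atLeastAtMost_iff by linarith
    then show ?thesis by auto
  next
    case 3
    then have "of_int n * (2 * pi) \<le> (-1) * (2 * pi)" by (intro mult_right_mono) auto
    with n assms(2,3) have "a = 0 \<and> b = 2 * pi" unfolding atLeastAtMost_iff by linarith
    then show ?thesis by auto
  qed (use n in auto)
qed

text \<open>
  A continuous map from a compact space to a Hausdorff space is closed, hence a quotient map onto its
  image.
\<close>

lemma continuous_on_compact_quotient:
  fixes f :: "'a::topological_space \<Rightarrow> 'b::t2_space" and g :: "'b \<Rightarrow> 'c::topological_space"
  assumes "compact K" "continuous_on K f" "continuous_on K (\<lambda>x. g (f x))"
  shows "continuous_on (f ` K) g"
proof -
  have "\<exists>A. closed A \<and> A \<inter> f ` K = g -` B \<inter> f ` K" if "closed B" for B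
  proof -
    obtain C where C: "closed C" "C \<inter> K = (\<lambda>x. g (f x)) -` B \<inter> K"
      using assms(3) \<open>closed B\<close> unfolding continuous_on_closed_invariant by blast
    have "compact (C \<inter> K)" using C(1) assms(1) by (rule closed_Int_compact)
    then have "compact (f ` (C \<inter> K))"
      by (intro compact_continuous_image continuous_on_subset[OF assms(2)]) auto
    then have "closed (f ` (C \<inter> K))" by (rule compact_imp_closed)
    moreover have "f ` (C \<inter> K) \<inter> f ` K = g -` B \<inter> f ` K" unfolding C(2) by auto
    ultimately show ?thesis by blast
  qed
  then show ?thesis unfolding continuous_on_closed_invariant by blast
qed

text \<open>
  A function that vanishes on the boundary of the square is constant on the fibres of the embedding,
  so it descends to a continuous function on the torus in \<open>\<complex>\<^sup>2\<close>.
\<close>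

lemma trig_poly_uniform_approx:
  fixes f :: "real \<times> real \<Rightarrow> complex"
  assumes cont: "continuous_on ({0..2*pi} \<times> {0..2*pi}) f"
    and vanish: "\<And>z. z \<in> {0..2*pi} \<times> {0..2*pi} \<Longrightarrow> fst z \<in> {0, 2*pi} \<or> snd z \<in> {0, 2*pi} \<Longrightarrow> f z = 0"
    and "0 < e"
  obtains Q where "Q \<in> trig_poly UNIV" "\<And>z. z \<in> {0..2*pi} \<times> {0..2*pi} \<Longrightarrow> norm (f z - Q z) < e"
proof -
  define K where "K = {0..2*pi} \<times> {0..2*pi}"
  have K: "compact K" unfolding K_def by (intro compact_Times compact_Icc)
  \<comment> \<open>The function induced by \<open>f\<close> on the image of the square; all preimages of a point give the same value.\<close>
  define F where "F = (\<lambda>w. f (SOME z. z \<in> K \<and> torus_embedding z = w))"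
  have F: "F (torus_embedding z) = f z" if "z \<in> K" for z
  proof -
    define z' where "z' = (SOME z'. z' \<in> K \<and> torus_embedding z' = torus_embedding z)"
    have z': "z' \<in> K \<and> torus_embedding z' = torus_embedding z"
      unfolding z'_def by (rule someI[of _ z]) (use that in auto)
    then have "cis (fst z') = cis (fst z)" "cis (snd z') = cis (snd z)"
      by (auto simp: torus_embedding_def)
    then have "z' = z \<or> ((fst z' \<in> {0,2*pi} \<or> snd z' \<in> {0,2*pi}) \<and> (fst z \<in> {0,2*pi} \<or> snd z \<in> {0,2*pi}))"
      using z' that cis_eq_imp[of "fst z'" "fst z"] cis_eq_imp[of "snd z'" "snd z"]
      unfolding K_def mem_Times_iff prod_eq_iff by blast
    then have "f z' = f z"
      using vanish[of z] vanish[of z'] z' that unfolding K_def by auto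
    then show ?thesis by (simp add: F_def z'_def)
  qed
  have "continuous_on (torus_embedding ` K) F"
  proof (rule continuous_on_compact_quotient[OF K continuous_on_torus_embedding])
    show "continuous_on K (\<lambda>z. F (torus_embedding z))"
      using cont unfolding K_def[symmetric] by (rule continuous_on_eq) (simp add: F)
  qed
  from Stone_Weierstrass_polynomial_function[OF compact_continuous_image[OF continuous_on_torus_embedding K] this \<open>0 < e\<close>]
  obtain g where g: "polynomial_function g" "\<And>w. w \<in> torus_embedding ` K \<Longrightarrow> norm (F w - g w) < e"
    by blast
  show thesis
  proof (rule that[OF polynomial_comp_embedding[OF g(1)]])
    show "norm (f z - g (torus_embedding z)) < e" if "z \<in> {0..2*pi} \<times> {0..2*pi}" for z
      using g(2)[of "torus_embedding z"] F[of z] that by (auto simp: K_def)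
  qed
qed

lemma cutoff_tendsto_1:
  fixes s :: real assumes "s \<noteq> 0"
  shows "(\<lambda>n. min 1 (real n * \<bar>s\<bar>)) \<longlonglongrightarrow> 1"
proof -
  have "eventually (\<lambda>n. real n \<ge> 1 / \<bar>s\<bar>) sequentially"
    using eventually_ge_at_top[of "nat \<lceil>1 / \<bar>s\<bar>\<rceil>"] by eventually_elim linarith
  then have "eventually (\<lambda>n. min 1 (real n * \<bar>s\<bar>) = 1) sequentially"
    by eventually_elim (use assms in \<open>auto simp: field_simps min_def\<close>)
  then show ?thesis by (rule tendsto_eventually)
qed

text \<open>
  A measurable function is an almost everywhere limit of continuous functions. Projecting these onto
  the ball of radius \<open>B\<close> keeps them bounded, and the factor \<open>min 1 (n \<bar>sin (x/2) sin (y/2)\<bar>)\<close>, which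
  tends to \<open>1\<close> off a null set, makes them vanish on the boundary of the square, so that they have
  uniform approximations by trigonometric polynomials.
\<close>

lemma bounded_approx_trig_poly:
  fixes P :: "real \<times> real \<Rightarrow> complex"
  assumes P: "P \<in> borel_measurable torus2" and B: "\<And>z. z \<in> space torus2 \<Longrightarrow> norm (P z) \<le> B"
  obtains Q where "\<And>n. Q n \<in> trig_poly UNIV"
    "\<And>n z. z \<in> space torus2 \<Longrightarrow> norm (Q n z) \<le> B + 1"
    "AE z in torus2. (\<lambda>n. Q n z) \<longlonglongrightarrow> P z"
proof -
  have "0 \<le> B" using B[of "(0,0)"] norm_ge_zero[of "P (0,0)"] unfolding space_torus2 circle_dom_def
    by (smt (verit) atLeastLessThan_iff mem_Sigma_iff pi_gt_zero)
  define T where "T = circle_dom \<times> circle_dom"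
  have "P measurable_on T"
    using P torus2_dom_lmeasurable by (simp add: measurable_on_iff_borel_measurable torus2_def T_def)
  then obtain N g where N: "negligible N" and g: "\<And>n. continuous_on UNIV (g n)"
    and gP: "\<And>z. z \<notin> N \<Longrightarrow> (\<lambda>n. g n z) \<longlonglongrightarrow> (if z \<in> T then P z else 0)"
    unfolding measurable_on_def by blast
  define s where "s = (\<lambda>z::real \<times> real. sin (fst z / 2) * sin (snd z / 2))"
  define h where "h = (\<lambda>n z. of_real (min 1 (real n * \<bar>s z\<bar>)) * closest_point (cball 0 B) (g n z))"
  have cp: "norm (closest_point (cball 0 B) w) \<le> B" for w :: complex
    using closest_point_in_set[of "cball (0::complex) B" w] \<open>0 \<le> B\<close> by auto
  have hB: "norm (h n z) \<le> B" for n z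
  proof -
    have "norm (h n z) = \<bar>min 1 (real n * \<bar>s z\<bar>)\<bar> * norm (closest_point (cball 0 B) (g n z))"
      by (simp only: h_def norm_mult norm_of_real)
    also have "\<dots> \<le> 1 * B" by (intro mult_mono cp) auto
    finally show ?thesis by simp
  qed
  have cpc: "continuous_on UNIV (closest_point (cball (0::complex) B))"
    using \<open>0 \<le> B\<close> by (intro continuous_on_closest_point) auto
  have hc: "continuous_on A (h n)" for n A
    unfolding h_def s_def
    by (intro continuous_intros continuous_on_compose2[OF cpc] continuous_on_subset[OF g]) auto
  have "\<exists>Q. Q \<in> trig_poly UNIV \<and> (\<forall>z \<in> {0..2*pi} \<times> {0..2*pi}. norm (h n z - Q z) < inverse (real (Suc n)))" for n
  proof -
    have "h n z = 0" if "fst z \<in> {0, 2*pi} \<or> snd z \<in> {0, 2*pi}" for z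
      using that by (auto simp: h_def s_def)
    then have vanish: "h n z = 0" if "z \<in> {0..2*pi} \<times> {0..2*pi}" "fst z \<in> {0, 2*pi} \<or> snd z \<in> {0, 2*pi}" for z
      using that by blast
    have "0 < inverse (real (Suc n))" by simp
    from trig_poly_uniform_approx[OF hc vanish this] show ?thesis by metis
  qed
  then obtain Q where Q: "\<And>n. Q n \<in> trig_poly UNIV"
    "\<And>n z. z \<in> {0..2*pi} \<times> {0..2*pi} \<Longrightarrow> norm (h n z - Q n z) < inverse (real (Suc n))"
    by metis
  have T: "space torus2 \<subseteq> {0..2*pi} \<times> {0..2*pi}" by (auto simp: space_torus2 circle_dom_def)
  show thesis
  proof (rule that[of Q])
    show "norm (Q n z) \<le> B + 1" if "z \<in> space torus2" for n z
    proof -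
      have "norm (Q n z) \<le> norm (h n z) + norm (h n z - Q n z)" by (metis norm_triangle_sub norm_minus_commute)
      also have "\<dots> \<le> B + inverse (real (Suc n))" using Q(2)[of z n] that T hB[of n z] by force
      also have "inverse (real (Suc n)) \<le> 1" by (simp add: inverse_le_1_iff)
      finally show ?thesis by simp
    qed
    have "negligible (N \<union> {z. s z = 0} \<inter> T)"
    proof -
      have "x = 0" if "sin (x / 2) = 0" "x \<in> circle_dom" for x
        using that sin_gt_zero[of "x / 2"] by (force simp: circle_dom_def)
      then have "{z. s z = 0} \<inter> T \<subseteq> {z. z \<bullet> (1, 0) = 0} \<union> {z. z \<bullet> (0, 1) = 0}"
        by (auto simp: s_def T_def)
      moreover have "negligible ({z::real \<times> real. z \<bullet> (1, 0) = 0} \<union> {z. z \<bullet> (0, 1) = 0})"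
        by (intro negligible_Un negligible_standard_hyperplane) (auto simp: Basis_prod_def)
      ultimately show ?thesis
        using N negligible_subset negligible_Un by metis
    qed
    then have "AE z in lebesgue. z \<notin> N \<union> {z. s z = 0} \<inter> T"
      unfolding negligible_iff_null_sets by (rule AE_not_in)
    then have "AE z in lebesgue. z \<in> T \<longrightarrow> z \<notin> N \<and> s z \<noteq> 0"
      by (rule eventually_mono) auto
    then have "AE z in torus2. z \<notin> N \<and> s z \<noteq> 0"
      unfolding torus2_def T_def using torus2_dom_lmeasurable
      by (subst AE_restrict_space_iff) simp_all
    moreover have "(\<lambda>n. Q n z) \<longlonglongrightarrow> P z" if z: "z \<notin> N \<and> s z \<noteq> 0" "z \<in> space torus2" for z
    proof -
      have zT: "z \<in> T" using z by (simp add: T_def space_torus2)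
      have "(\<lambda>n. g n z) \<longlonglongrightarrow> P z" using gP[of z] z zT by simp
      then have "(\<lambda>n. closest_point (cball 0 B) (g n z)) \<longlonglongrightarrow> closest_point (cball 0 B) (P z)"
        by (intro isCont_tendsto_compose[of _ "closest_point (cball 0 B)"])
           (use cpc in \<open>simp_all add: continuous_on_eq_continuous_at\<close>)
      then have "(\<lambda>n. closest_point (cball 0 B) (g n z)) \<longlonglongrightarrow> P z"
        using B[of z] z by (simp add: closest_point_self)
      moreover have "(\<lambda>n. complex_of_real (min 1 (real n * \<bar>s z\<bar>))) \<longlonglongrightarrow> of_real 1"
        using cutoff_tendsto_1[of "s z"] z by (intro tendsto_of_real) auto
      ultimately have "(\<lambda>n. h n z) \<longlonglongrightarrow> of_real 1 * P z"
        unfolding h_def by (rule tendsto_mult[rotated])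
      moreover have "(\<lambda>n. h n z - Q n z) \<longlonglongrightarrow> 0"
      proof (rule tendsto_norm_zero_cancel, rule tendsto_sandwich[OF _ _ tendsto_const LIMSEQ_inverse_real_of_nat])
        show "\<forall>\<^sub>F n in sequentially. norm (h n z - Q n z) \<le> inverse (real (Suc n))"
          using Q(2)[of z] T z(2) by (intro always_eventually) (auto intro: less_imp_le)
      qed auto
      ultimately have "(\<lambda>n. h n z - (h n z - Q n z)) \<longlonglongrightarrow> of_real 1 * P z - 0"
        by (rule tendsto_diff)
      then show ?thesis by simp
    qed
    ultimately show "AE z in torus2. (\<lambda>n. Q n z) \<longlonglongrightarrow> P z"
      by (auto elim!: AE_mp)
  qed (use Q in auto)
qed

section \<open>From bounded functionals to integrable quotients\<close>

lemma conjugate_exponent_cases: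
  assumes "1 \<le> p" "1 / ennreal p + 1 / p' = 1"
  obtains "p = 1" "p' = \<infinity>" | q where "1 < p" "1 < q" "1 / p + 1 / q = 1" "p' = ennreal q"
proof (cases "p = 1")
  case True
  with assms(2) have "1 + 1 / p' = 1 + 0" by simp
  then have "1 / p' = 0" by (subst (asm) ennreal_add_left_cancel) simp
  then have "p' = \<infinity>" by (simp add: ennreal_divide_eq_0_iff)
  with True that show ?thesis by blast
next
  case False
  with assms have p: "1 < p" by simp
  have p'0: "p' \<noteq> 0" using assms(2) by (auto simp: ennreal_divide_zero)
  show ?thesis
  proof (cases p')
    case (real r)
    with p'0 have "r > 0" by (cases "r = 0") auto
    have "ennreal (1 / p + 1 / r) = ennreal 1"
      using assms(2) p \<open>r > 0\<close> real by (simp add: divide_ennreal[symmetric])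
    then have e: "1 / p + 1 / r = 1" using p \<open>r > 0\<close> by (subst (asm) ennreal_inj) auto
    have "0 < 1 / p" using p by simp
    then have "1 / r < 1" using e by linarith
    then have "1 < r" using \<open>r > 0\<close> by (simp add: divide_less_eq)
    with that p e real show ?thesis by blast
  next
    case top
    with assms(2) have "ennreal (1 / p) = ennreal 1"
      using p by (simp add: divide_ennreal[symmetric])
    then have "1 / p = 1" using p by (subst (asm) ennreal_inj) auto
    with p show ?thesis by simp
  qed
qed

text \<open>
  Bounded almost everywhere convergence passes to the limit on both sides: \<open>u\<close> is bounded on a finite
  measure space, and \<open>M\<close> is in \<open>L\<^sup>p\<close>.
\<close>

lemma integral_bound_extends:
  assumes p: "1 \<le> p" and M: "M \<in> Lp_space p"
    and u: "u \<in> borel_measurable torus2" "\<And>z. norm (u z) \<le> U"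
    and bound: "\<And>Q. Q \<in> trig_poly UNIV \<Longrightarrow> norm (\<integral>z. Q z * u z \<partial>torus2) \<le> C * Lp_norm p (\<lambda>z. M z * Q z)"
    and P: "P \<in> borel_measurable torus2" "\<And>z. z \<in> space torus2 \<Longrightarrow> norm (P z) \<le> B"
  shows "norm (\<integral>z. P z * u z \<partial>torus2) \<le> C * Lp_norm p (\<lambda>z. M z * P z)"
proof -
  obtain Q where Q: "\<And>n. Q n \<in> trig_poly UNIV"
    "\<And>n z. z \<in> space torus2 \<Longrightarrow> norm (Q n z) \<le> B + 1"
    "AE z in torus2. (\<lambda>n. Q n z) \<longlonglongrightarrow> P z"
    using bounded_approx_trig_poly[OF P] by blast
  have Qm [measurable]: "Q n \<in> borel_measurable torus2" for n
    using trig_poly_continuous[OF Q(1)] by (rule continuous_imp_measurable_torus2)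
  have Mm [measurable]: "M \<in> borel_measurable torus2" using M by (rule Lp_space_measurable)
  note [measurable] = u(1) P(1)
  have "(\<lambda>n. \<integral>z. Q n z * u z \<partial>torus2) \<longlonglongrightarrow> (\<integral>z. P z * u z \<partial>torus2)"
  proof (rule integral_dominated_convergence)
    show "AE z in torus2. (\<lambda>n. Q n z * u z) \<longlonglongrightarrow> P z * u z"
      using Q(3) by eventually_elim (intro tendsto_intros)
    show "integrable torus2 (\<lambda>z. (B + 1) * U)" by simp
    show "AE z in torus2. norm (Q n z * u z) \<le> (B + 1) * U" for n
    proof (rule AE_I2)
      fix z assume "z \<in> space torus2"
      from Q(2)[OF this, of n] show "norm (Q n z * u z) \<le> (B + 1) * U"
        unfolding norm_mult by (intro mult_mono u(2)) (auto intro: order_trans[OF norm_ge_zero])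
    qed
  qed measurable
  then have lhs: "(\<lambda>n. norm (\<integral>z. Q n z * u z \<partial>torus2)) \<longlonglongrightarrow> norm (\<integral>z. P z * u z \<partial>torus2)"
    by (rule tendsto_norm)
  have "(\<lambda>n. Lp_norm p (\<lambda>z. M z * Q n z)) \<longlonglongrightarrow> Lp_norm p (\<lambda>z. M z * P z)"
  proof (rule Lp_norm_tendsto[OF p])
    show "integrable torus2 (\<lambda>z. (norm (M z) * \<bar>B + 1\<bar>) powr p)"
      using M by (simp add: powr_mult Lp_space_def)
    show "AE z in torus2. norm (M z * Q n z) \<le> norm (M z) * \<bar>B + 1\<bar>" for n
    proof (rule AE_I2)
      fix z assume "z \<in> space torus2"
      from Q(2)[OF this, of n] show "norm (M z * Q n z) \<le> norm (M z) * \<bar>B + 1\<bar>"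
        unfolding norm_mult by (intro mult_left_mono) auto
    qed
    show "AE z in torus2. (\<lambda>n. M z * Q n z) \<longlonglongrightarrow> M z * P z"
      using Q(3) by eventually_elim (intro tendsto_intros)
  qed measurable
  then have "(\<lambda>n. C * Lp_norm p (\<lambda>z. M z * Q n z)) \<longlonglongrightarrow> C * Lp_norm p (\<lambda>z. M z * P z)"
    by (intro tendsto_intros)
  from LIMSEQ_le[OF lhs this] bound[OF Q(1)] show ?thesis by blast
qed

text \<open>
  \<open>min n (1 / \<bar>M\<bar>)\<close> with the convention \<open>1 / 0 = \<infinity>\<close>.
\<close>

definition truncated_reciprocal :: "(real \<times> real \<Rightarrow> complex) \<Rightarrow> nat \<Rightarrow> real \<times> real \<Rightarrow> real" where
  "truncated_reciprocal M n z = (if M z = 0 then real n else min (real n) (1 / norm (M z)))"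

lemma truncated_reciprocal_bounds:
  "0 \<le> truncated_reciprocal M n z" "truncated_reciprocal M n z \<le> real n"
  "norm (M z) * truncated_reciprocal M n z \<le> 1"
  by (auto simp: truncated_reciprocal_def min_def field_simps)

lemma truncated_reciprocal_measurable [measurable]:
  assumes [measurable]: "M \<in> borel_measurable torus2"
  shows "truncated_reciprocal M n \<in> borel_measurable torus2"
  unfolding truncated_reciprocal_def[abs_def] by measurable

lemma powr_at_top:
  fixes q :: real
  assumes "0 < q" shows "filterlim (\<lambda>x. x powr q) at_top at_top"
proof -
  have "filterlim (\<lambda>x. exp (q * ln x)) at_top at_top"
    by (intro filterlim_compose[OF exp_at_top] filterlim_tendsto_pos_mult_at_top[OF tendsto_const assms] ln_at_top)
  moreover have "eventually (\<lambda>x::real. exp (q * ln x) = x powr q) at_top"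
    using eventually_gt_at_top[of 0] by eventually_elim (simp add: powr_def)
  ultimately show ?thesis using filterlim_cong[OF refl refl] by fast
qed

text \<open>
  The phase factor of the test functions below.
\<close>

lemma cnj_sgn_mult: "cnj (sgn w) * w = of_real (norm w)"
proof (cases "w = 0")
  case False
  have "cnj (sgn w) * w = (w * cnj w) / of_real (norm w)"
    by (simp add: sgn_eq mult.commute)
  also have "\<dots> = of_real (norm w)"
    using False by (simp add: complex_norm_square[symmetric] power2_eq_square)
  finally show ?thesis .
qed simp

text \<open>
  At a common zero of \<open>u\<close> and \<open>M\<close> both sides are \<open>0\<close>, by the convention \<open>0 \<cdot> \<infinity> = 0\<close>; at a zero of \<open>M\<close>
  alone both are infinite.
\<close>

lemma truncated_reciprocal_tendsto:
  assumes "0 < q"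
  shows "(\<lambda>n. ennreal ((norm (u z) * truncated_reciprocal M n z) powr q))
    \<longlonglongrightarrow> ennreal_powr (ennreal (norm (u z :: complex)) * recip_modulus M z) q"
proof -
  consider "u z = 0" | "u z \<noteq> 0" "M z = 0" | "u z \<noteq> 0" "M z \<noteq> 0" by blast
  then show ?thesis
  proof cases
    case 1
    then show ?thesis using assms by (simp add: ennreal_powr_def)
  next
    case 2
    have "filterlim (\<lambda>n. norm (u z) * real n) at_top sequentially"
      using 2 by (intro filterlim_tendsto_pos_mult_at_top[OF tendsto_const _ filterlim_real_sequentially]) auto
    then have "filterlim (\<lambda>n. (norm (u z) * real n) powr q) at_top sequentially"
      by (rule filterlim_compose[OF powr_at_top[OF assms]])
    then show ?thesis
      using 2 by (simp add: truncated_reciprocal_def recip_modulus_def ennreal_powr_def ennreal_mult_top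
        ennreal_tendsto_top_eq_at_top)
  next
    case 3
    have "recip_modulus M z = ennreal (1 / norm (M z))"
      using 3 by (simp add: recip_modulus_def inverse_ennreal divide_inverse)
    then have "ennreal_powr (ennreal (norm (u z)) * recip_modulus M z) q = ennreal ((norm (u z) * (1 / norm (M z))) powr q)"
      by (simp add: ennreal_powr_def ennreal_mult[symmetric])
    moreover have "eventually (\<lambda>n. truncated_reciprocal M n z = 1 / norm (M z)) sequentially"
      using eventually_ge_at_top[of "nat \<lceil>1 / norm (M z)\<rceil>"]
    proof eventually_elim
      case (elim n)
      then have "1 / norm (M z) \<le> real n" by linarith
      then show ?case using 3 by (simp add: truncated_reciprocal_def)
    qed
    then have "eventually (\<lambda>n. ennreal ((norm (u z) * truncated_reciprocal M n z) powr q) = ennreal ((norm (u z) * (1 / norm (M z))) powr q)) sequentially"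
      by eventually_elim simp
    ultimately show ?thesis by (simp add: tendsto_eventually)
  qed
qed

text \<open>
  For \<open>p > 1\<close>, with \<open>q = p'\<close> and \<open>w = min n (1 / \<bar>M\<bar>)\<close>, the test function
  \<open>P = cnj (sgn u) \<bar>u\<bar>\<^sup>q\<^sup>-\<^sup>1 w\<^sup>q\<close> satisfies \<open>P u = (\<bar>u\<bar> w)\<^sup>q\<close> and, because \<open>\<bar>M\<bar> w \<le> 1\<close> and
  \<open>q p = q + p\<close>, also \<open>\<bar>M P\<bar>\<^sup>p \<le> (\<bar>u\<bar> w)\<^sup>q\<close>. For \<open>I = \<integral> (\<bar>u\<bar> w)\<^sup>q\<close> the hypothesis reads
  \<open>I \<le> C I\<^sup>1\<^sup>/\<^sup>p\<close>, so \<open>I \<le> C\<^sup>q\<close> independently of \<open>n\<close>, and Fatou's lemma concludes. For \<open>p = 1\<close> the test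
  function is the phase of \<open>u\<close> on the set where \<open>\<bar>u\<bar> > (C + 1) \<bar>M\<bar>\<close>, which must then be a null set.
\<close>

lemma power_integral_finite_if_bound:
  assumes p: "1 \<le> p" and p': "1 / ennreal p + 1 / p' = 1" and M: "M \<in> Lp_space p"
    and u: "u \<in> borel_measurable torus2" "\<And>z. norm (u z) \<le> U" and C: "0 \<le> C"
    and bound: "\<And>Q. Q \<in> trig_poly UNIV \<Longrightarrow> norm (\<integral>z. Q z * u z \<partial>torus2) \<le> C * Lp_norm p (\<lambda>z. M z * Q z)"
  shows "power_integral p' (\<lambda>z. ennreal (norm (u z)) * recip_modulus M z) < \<infinity>"
proof -
  have ext: "norm (\<integral>z. P z * u z \<partial>torus2) \<le> C * Lp_norm p (\<lambda>z. M z * P z)"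
    if "P \<in> borel_measurable torus2" "\<And>z. norm (P z) \<le> B" for P B
    using integral_bound_extends[OF p M u bound that(1)] that(2) by blast
  have Mm [measurable]: "M \<in> borel_measurable torus2" using M by (rule Lp_space_measurable)
  note [measurable] = u(1)
  have [measurable]: "(\<lambda>z. cnj (sgn (u z))) \<in> borel_measurable torus2"
  proof -
    have "cnj \<in> borel_measurable borel"
      by (intro borel_measurable_continuous_onI continuous_intros)
    moreover have "(\<lambda>z. sgn (u z)) \<in> borel_measurable torus2"
      unfolding sgn_div_norm by measurable
    ultimately show ?thesis by (rule measurable_compose[rotated])
  qed
  from p p' show ?thesis
  proof (cases rule: conjugate_exponent_cases)
    case 1
    define A where "A = {z \<in> space torus2. norm (u z) > (C + 1) * norm (M z)}"
    have A [measurable]: "A \<in> sets torus2" unfolding A_def by measurable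
    have Mi: "integrable torus2 (\<lambda>z. norm (M z))" using M 1 by (simp add: Lp_space_def)
    then have MAi: "integrable torus2 (\<lambda>z. indicator A z * norm (M z))"
      using integrable_mult_indicator[OF A Mi] by simp
    have ui: "integrable torus2 (\<lambda>z. indicator A z * norm (u z))"
      using u(2) norm_ge_zero[THEN order_trans, OF u(2)]
      by (intro torus2_integrable_bounded[where B = U]) (auto simp: indicator_def)
    define P where "P = (\<lambda>z. cnj (sgn (u z)) * indicator A z)"
    have Pm: "P \<in> borel_measurable torus2" unfolding P_def using A by measurable
    have PB: "norm (P z) \<le> 1" for z by (auto simp: P_def norm_mult norm_sgn indicator_def)
    have Pu: "P z * u z = of_real (indicator A z * norm (u z))" for z
      using cnj_sgn_mult[of "u z"] by (simp add: P_def indicator_def)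
    have MP: "norm (M z * P z) = indicator A z * norm (M z)" for z
    proof (cases "z \<in> A")
      case True
      then have "norm (u z) > 0" using C unfolding A_def
        by (smt (verit) mem_Collect_eq mult_nonneg_nonneg norm_ge_zero)
      with True show ?thesis by (simp add: P_def norm_mult norm_sgn)
    qed (simp add: P_def)
    have Au: "(\<integral>z. indicator A z * norm (u z) \<partial>torus2) \<le> C * (\<integral>z. indicator A z * norm (M z) \<partial>torus2)"
    proof -
      have "\<bar>\<integral>z. indicator A z * norm (u z) \<partial>torus2\<bar> \<le> C * Lp_norm p (\<lambda>z. M z * P z)"
        using ext[OF Pm PB] by (simp add: Pu integral_complex_of_real del: of_real_mult)
      moreover have "Lp_norm p (\<lambda>z. M z * P z) = (\<integral>z. indicator A z * norm (M z) \<partial>torus2)"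
        using 1 by (simp add: Lp_norm_def MP)
      ultimately show ?thesis by simp
    qed
    have "(C + 1) * (\<integral>z. indicator A z * norm (M z) \<partial>torus2) \<le> (\<integral>z. indicator A z * norm (u z) \<partial>torus2)"
      unfolding integral_mult_right_zero[symmetric] using MAi ui
      by (intro integral_mono) (auto simp: A_def indicator_def)
    with Au have "(\<integral>z. indicator A z * norm (M z) \<partial>torus2) \<le> 0" by (simp add: algebra_simps)
    moreover have "0 \<le> (\<integral>z. indicator A z * norm (M z) \<partial>torus2)" by (intro integral_nonneg_AE) auto
    ultimately have "(\<integral>z. indicator A z * norm (M z) \<partial>torus2) = 0" by linarith
    with Au have "(\<integral>z. indicator A z * norm (u z) \<partial>torus2) \<le> 0" by simp
    moreover have "0 \<le> (\<integral>z. indicator A z * norm (u z) \<partial>torus2)" by (intro integral_nonneg_AE) auto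
    ultimately have "(\<integral>z. indicator A z * norm (u z) \<partial>torus2) = 0" by linarith
    then have "AE z in torus2. indicator A z * norm (u z) = 0"
      using ui by (subst (asm) integral_nonneg_eq_0_iff_AE) auto
    then have "AE z in torus2. ennreal (norm (u z)) * recip_modulus M z \<le> ennreal (C + 1)"
    proof (rule AE_mp, intro AE_I2 impI)
      fix z assume z: "z \<in> space torus2" "indicator A z * norm (u z) = 0"
      have le: "norm (u z) \<le> (C + 1) * norm (M z)"
      proof (cases "z \<in> A")
        case True
        with z have "u z = 0" by simp
        then show ?thesis using C by simp
      qed (use z in \<open>auto simp: A_def\<close>)
      show "ennreal (norm (u z)) * recip_modulus M z \<le> ennreal (C + 1)"
      proof (cases "M z = 0")
        case True
        with le show ?thesis by simp
      next
        case False
        then have "ennreal (norm (u z)) * recip_modulus M z = ennreal (norm (u z) / norm (M z))"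
          by (simp add: recip_modulus_def inverse_ennreal ennreal_mult[symmetric] divide_inverse)
        also have "\<dots> \<le> ennreal (C + 1)" using le False by (intro ennreal_leI) (simp add: divide_le_eq)
        finally show ?thesis .
      qed
    qed
    then have "esssup torus2 (\<lambda>z. ennreal (norm (u z)) * recip_modulus M z) \<le> ennreal (C + 1)"
      by (intro esssup_I) (auto simp: recip_modulus_def[abs_def])
    also have "\<dots> < \<infinity>" by simp
    finally show ?thesis using 1 by (simp add: power_integral_def)
  next
    case (2 q)
    have pq: "p * (q - 1) = q" "q * p = q + p" using 2 by (auto simp: field_simps)
    define w where "w = truncated_reciprocal M"
    note wb = truncated_reciprocal_bounds[of M, folded w_def]
    have [measurable]: "w n \<in> borel_measurable torus2" for n by (simp add: w_def)
    have U: "0 \<le> U" using u(2) norm_ge_zero order_trans by blast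
    have int: "integrable torus2 (\<lambda>z. (norm (u z) * w n z) powr q)" for n
    proof (rule torus2_integrable_bounded)
      show "norm ((norm (u z) * w n z) powr q) \<le> (U * real n) powr q" for z
      proof -
        have "(norm (u z) * w n z) powr q \<le> (U * real n) powr q"
          using 2 by (intro powr_mono2 mult_mono mult_nonneg_nonneg u(2) wb(1,2) U norm_ge_zero) auto
        then show ?thesis by simp
      qed
    qed measurable
    have I: "(\<integral>z. (norm (u z) * w n z) powr q \<partial>torus2) \<le> C powr q" for n
    proof -
      define I where "I = (\<integral>z. (norm (u z) * w n z) powr q \<partial>torus2)"
      have "0 \<le> I" unfolding I_def by (intro integral_nonneg_AE) auto
      define P where "P = (\<lambda>z. cnj (sgn (u z)) * of_real (norm (u z) powr (q - 1) * w n z powr q))"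
      have Pm: "P \<in> borel_measurable torus2" unfolding P_def by measurable
      have PB: "norm (P z) \<le> 1 * (U powr (q - 1) * real n powr q)" for z
        unfolding P_def norm_mult norm_of_real abs_mult complex_mod_cnj
        using 2 by (intro mult_mono powr_mono2 u(2) wb(1,2) abs_ge_zero mult_nonneg_nonneg norm_ge_zero powr_ge_zero)
          (auto simp: norm_sgn intro!: powr_mono2 u(2) wb(1,2))
      have Pu: "P z * u z = of_real ((norm (u z) * w n z) powr q)" for z
      proof (cases "u z = 0")
        case False
        have "P z * u z = (cnj (sgn (u z)) * u z) * of_real (norm (u z) powr (q - 1) * w n z powr q)"
          by (simp add: P_def mult_ac)
        also have "\<dots> = of_real (norm (u z) * (norm (u z) powr (q - 1) * w n z powr q))"
          by (simp only: cnj_sgn_mult of_real_mult)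
        also have "norm (u z) * (norm (u z) powr (q - 1) * w n z powr q) = norm (u z) powr q * w n z powr q"
          using False by (simp add: powr_diff)
        finally show ?thesis using wb by (simp add: powr_mult)
      qed (use 2 in \<open>simp add: P_def\<close>)
      have MP: "norm (M z * P z) powr p \<le> (norm (u z) * w n z) powr q" for z
      proof (cases "u z = 0")
        case False
        then have "norm (M z * P z) = norm (M z) * (norm (u z) powr (q - 1) * w n z powr q)"
          by (simp add: P_def norm_mult norm_sgn)
        then have "norm (M z * P z) powr p = norm (M z) powr p * (norm (u z) powr (p * (q - 1)) * w n z powr (q * p))"
          by (simp add: powr_mult powr_powr mult.commute)
        also have "\<dots> = (norm (M z) * w n z) powr p * (norm (u z) * w n z) powr q"
          unfolding pq powr_add using wb by (simp add: powr_mult mult_ac)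
        also have "\<dots> \<le> 1 powr p * (norm (u z) * w n z) powr q"
          using wb p by (intro mult_right_mono powr_mono2) auto
        finally show ?thesis by simp
      qed (use p in \<open>simp add: P_def\<close>)
      have MPi: "integrable torus2 (\<lambda>z. norm (M z * P z) powr p)"
        by (rule Bochner_Integration.integrable_bound[OF int[of n]])
           (use MP Pm in auto)
      have "\<bar>I\<bar> \<le> C * Lp_norm p (\<lambda>z. M z * P z)"
        using ext[OF Pm PB] unfolding Pu by (simp add: I_def integral_complex_of_real)
      moreover have "Lp_norm p (\<lambda>z. M z * P z) \<le> I powr (1 / p)"
        unfolding Lp_norm_def I_def using p MP MPi int
        by (intro powr_mono2 integral_mono) (auto intro!: integral_nonneg_AE)
      ultimately have le: "I \<le> C * I powr (1 / p)"
        using C by (smt (verit) mult_left_mono)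
      show "I \<le> C powr q"
      proof (cases "I = 0")
        case False
        with \<open>0 \<le> I\<close> have "0 < I" by simp
        \<comment> \<open>Divide \<open>I \<le> C I\<^sup>1\<^sup>/\<^sup>p\<close> by \<open>I\<^sup>1\<^sup>/\<^sup>p\<close>.\<close>
        have "1 / q = 1 - 1 / p" using 2 by simp
        then have "I powr (1 / q) = I / I powr (1 / p)" using \<open>0 < I\<close> by (simp add: powr_diff)
        also have "\<dots> \<le> C" using le \<open>0 < I\<close> by (simp add: divide_le_eq)
        finally have "(I powr (1 / q)) powr q \<le> C powr q" using 2 by (intro powr_mono2) auto
        then show ?thesis using 2 \<open>0 < I\<close> by (simp add: powr_powr)
      qed simp
    qed
    have "power_integral p' (\<lambda>z. ennreal (norm (u z)) * recip_modulus M z)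
        = (\<integral>\<^sup>+ z. ennreal_powr (ennreal (norm (u z)) * recip_modulus M z) q \<partial>torus2)"
      using 2 by (simp add: power_integral_def)
    also have "\<dots> = (\<integral>\<^sup>+ z. liminf (\<lambda>n. ennreal ((norm (u z) * w n z) powr q)) \<partial>torus2)"
    proof (intro nn_integral_cong)
      have "0 < q" using 2 by simp
      from lim_imp_Liminf[OF trivial_limit_sequentially truncated_reciprocal_tendsto[OF this, of u z M for z]]
      show "ennreal_powr (ennreal (norm (u z)) * recip_modulus M z) q = liminf (\<lambda>n. ennreal ((norm (u z) * w n z) powr q))" for z
        unfolding w_def by (rule sym)
    qed
    also have "\<dots> \<le> liminf (\<lambda>n. \<integral>\<^sup>+ z. ennreal ((norm (u z) * w n z) powr q) \<partial>torus2)"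
      by (rule nn_integral_liminf) measurable
    also have "\<dots> \<le> ennreal (C powr q)"
    proof (rule Liminf_le)
      show "\<forall>\<^sub>F n in sequentially. (\<integral>\<^sup>+ z. ennreal ((norm (u z) * w n z) powr q) \<partial>torus2) \<le> ennreal (C powr q)"
        using I by (intro always_eventually allI) (subst nn_integral_eq_integral[OF int], auto intro: ennreal_leI)
    qed simp
    also have "\<dots> < \<infinity>" by simp
    finally show ?thesis .
  qed
qed

section \<open>From integrable quotients to bounded functionals\<close>

lemma AE_finite_if_power_integral_finite:
  assumes p: "1 \<le> p" and p': "1 / ennreal p + 1 / p' = 1"
    and F: "F \<in> borel_measurable torus2" and fin: "power_integral p' F < \<infinity>"
  shows "AE z in torus2. F z < \<infinity>"
  using p p'
proof (cases rule: conjugate_exponent_cases)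
  case 1
  then have "esssup torus2 F < \<infinity>" using fin by (simp add: power_integral_def)
  then show ?thesis using esssup_AE[of F torus2] by (auto elim!: eventually_mono dest: le_less_trans)
next
  case (2 q)
  then have "(\<integral>\<^sup>+ z. ennreal_powr (F z) q \<partial>torus2) \<noteq> \<infinity>"
    using fin by (simp add: power_integral_def)
  moreover have "(\<lambda>z. ennreal_powr (F z) q) \<in> borel_measurable torus2"
    unfolding ennreal_powr_def using F by measurable
  ultimately have "AE z in torus2. ennreal_powr (F z) q \<noteq> \<infinity>"
    by (intro nn_integral_PInf_AE) auto
  then show ?thesis by eventually_elim (auto simp: ennreal_powr_def less_top[symmetric])
qed

lemma recip_modulus_measurable [measurable]:
  "M \<in> borel_measurable torus2 \<Longrightarrow> recip_modulus M \<in> borel_measurable torus2"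
  unfolding recip_modulus_def[abs_def] by measurable

text \<open>
  Where \<open>M = 0\<close> and \<open>u \<noteq> 0\<close>, the function \<open>\<bar>u\<bar> / \<bar>M\<bar>\<close> is infinite.
\<close>

lemma AE_nonzero_if_finite:
  assumes p: "1 \<le> p" and p': "1 / ennreal p + 1 / p' = 1"
    and [measurable]: "M \<in> borel_measurable torus2" "u \<in> borel_measurable torus2"
    and u: "AE z in torus2. u z \<noteq> (0 :: complex)"
    and fin: "power_integral p' (\<lambda>z. ennreal (norm (u z)) * recip_modulus M z) < \<infinity>"
  shows "AE z in torus2. M z \<noteq> 0"
proof -
  have "AE z in torus2. ennreal (norm (u z)) * recip_modulus M z < \<infinity>"
    by (rule AE_finite_if_power_integral_finite[OF p p' _ fin]) measurable
  with u show ?thesis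
    by eventually_elim (auto simp: recip_modulus_def ennreal_mult_top)
qed

text \<open>
  The constant \<open>c\<close> is there because the comparisons below hold up to a factor only.
\<close>

lemma power_integral_finite_mono:
  assumes p: "1 \<le> p" and p': "1 / ennreal p + 1 / p' = 1"
    and F: "F \<in> borel_measurable torus2" and G: "G \<in> borel_measurable torus2"
    and le: "\<And>z. F z \<le> ennreal c * G z"
    and fin: "power_integral p' G < \<infinity>"
  shows "power_integral p' F < \<infinity>"
  using p p'
proof (cases rule: conjugate_exponent_cases)
  case 1
  then have e: "esssup torus2 G < \<infinity>" using fin by (simp add: power_integral_def)
  have "esssup torus2 F \<le> ennreal c * esssup torus2 G"
  proof (rule esssup_I[OF F])
    show "AE z in torus2. F z \<le> ennreal c * esssup torus2 G"
      using esssup_AE[of G torus2]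
      by eventually_elim (rule order_trans[OF le], intro mult_left_mono, auto)
  qed
  also have "\<dots> < \<infinity>" using e by (simp add: ennreal_mult_less_top)
  finally show ?thesis using 1 by (simp add: power_integral_def)
next
  case (2 q)
  define c' where "c' = max c 0"
  have *: "ennreal_powr (F z) q \<le> ennreal (c' powr q) * ennreal_powr (G z) q"
    if G: "G z < \<infinity>" for z
  proof -
    have "F z \<le> ennreal c * G z" by (rule le)
    also have "\<dots> = ennreal (c' * enn2real (G z))"
      using G by (cases "G z") (auto simp: c'_def ennreal_mult' max_def ennreal_neg)
    finally have F: "F z \<le> ennreal (c' * enn2real (G z))" .
    then have "F z < \<infinity>" using le_less_trans ennreal_less_top by fastforce
    moreover have "enn2real (F z) \<le> c' * enn2real (G z)"
      using F by (intro enn2real_leI) (auto simp: c'_def)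
    then have "enn2real (F z) powr q \<le> c' powr q * enn2real (G z) powr q"
      using 2 by (subst powr_mult[symmetric]) (auto simp: c'_def intro!: powr_mono2)
    ultimately show ?thesis using G
      by (auto simp: ennreal_powr_def ennreal_mult[symmetric] intro!: ennreal_leI)
  qed
  have m: "(\<lambda>z. ennreal_powr (G z) q) \<in> borel_measurable torus2"
    unfolding ennreal_powr_def using G by measurable
  have "(\<integral>\<^sup>+ z. ennreal_powr (F z) q \<partial>torus2) \<le> (\<integral>\<^sup>+ z. ennreal (c' powr q) * ennreal_powr (G z) q \<partial>torus2)"
    using AE_finite_if_power_integral_finite[OF p p' G fin]
    by (intro nn_integral_mono_AE) (auto elim!: eventually_mono intro!: *)
  also have "\<dots> = ennreal (c' powr q) * (\<integral>\<^sup>+ z. ennreal_powr (G z) q \<partial>torus2)"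
    by (rule nn_integral_cmult[OF m])
  also have "\<dots> < \<infinity>"
    using fin 2 by (simp add: power_integral_def ennreal_mult_less_top)
  finally show ?thesis using 2 by (simp add: power_integral_def)
qed

text \<open>
  Hoelder's inequality with the constant \<open>1 + \<integral> (\<bar>u\<bar> / \<bar>M\<bar>)\<^sup>p\<^sup>'\<close> for \<open>p > 1\<close>. Young's inequality for
  \<open>(\<bar>f\<bar> / t) (\<bar>u\<bar> / \<bar>M\<bar>)\<close> gives the bound with any \<open>t > 0\<close> that is at least the norm of \<open>f\<close> in place of the norm; letting \<open>t\<close>
  decrease to it covers functions of norm \<open>0\<close>.
\<close>

lemma quotient_functional_bounded:
  assumes p: "1 \<le> p" and p': "1 / ennreal p + 1 / p' = 1"
    and [measurable]: "M \<in> borel_measurable torus2" "u \<in> borel_measurable torus2"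
    and fin: "power_integral p' (\<lambda>z. ennreal (norm (u z)) * recip_modulus M z) < \<infinity>"
    and M0: "AE z in torus2. M z \<noteq> (0 :: complex)"
  shows "\<exists>K\<ge>0. \<forall>f\<in>Lp_space p. integrable torus2 (\<lambda>z. norm (f z) * norm (u z) / norm (M z)) \<and>
    (\<integral>z. norm (f z) * norm (u z) / norm (M z) \<partial>torus2) \<le> K * Lp_norm p f"
proof -
  define v where "v = (\<lambda>z. norm (u z) / norm (M z))"
  have [measurable]: "v \<in> borel_measurable torus2" unfolding v_def by measurable
  have v0: "0 \<le> v z" for z by (simp add: v_def)
  have v_eq: "AE z in torus2. ennreal (norm (u z)) * recip_modulus M z = ennreal (v z)"
    using M0 by eventually_elim
      (simp add: recip_modulus_def v_def inverse_ennreal ennreal_mult[symmetric] divide_inverse)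
  have eq: "norm (f z) * norm (u z) / norm (M z) = norm (f z) * v z" for f :: "real \<times> real \<Rightarrow> complex" and z
    by (simp add: v_def)
  from p p' show ?thesis
  proof (cases rule: conjugate_exponent_cases)
    case 1
    define K where "K = enn2real (esssup torus2 (\<lambda>z. ennreal (norm (u z)) * recip_modulus M z))"
    have "esssup torus2 (\<lambda>z. ennreal (norm (u z)) * recip_modulus M z) = ennreal K"
      using fin 1 by (simp add: K_def power_integral_def)
    with esssup_AE[of "\<lambda>z. ennreal (norm (u z)) * recip_modulus M z" torus2]
    have "AE z in torus2. ennreal (norm (u z)) * recip_modulus M z \<le> ennreal K" by simp
    with v_eq have vK: "AE z in torus2. v z \<le> K"
      by eventually_elim (simp add: K_def)
    show ?thesis
    proof (intro exI[of _ K] conjI ballI)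
      show "0 \<le> K" by (simp add: K_def)
      fix f assume f: "f \<in> Lp_space p"
      then have [measurable]: "f \<in> borel_measurable torus2" by (rule Lp_space_measurable)
      have fi: "integrable torus2 (\<lambda>z. norm (f z) * K)" using f 1 by (simp add: Lp_space_def)
      have le: "AE z in torus2. norm (f z) * v z \<le> norm (f z) * K"
        using vK by eventually_elim (intro mult_left_mono, auto)
      show i: "integrable torus2 (\<lambda>z. norm (f z) * norm (u z) / norm (M z))"
        unfolding eq
        by (rule Bochner_Integration.integrable_bound[OF fi])
           (measurable, use le v0 in \<open>auto elim!: eventually_mono intro: order_trans[OF _ abs_ge_self]\<close>)
      have "(\<integral>z. norm (f z) * v z \<partial>torus2) \<le> (\<integral>z. norm (f z) * K \<partial>torus2)"
        using i le fi unfolding eq by (intro integral_mono_AE)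
      then show "(\<integral>z. norm (f z) * norm (u z) / norm (M z) \<partial>torus2) \<le> K * Lp_norm p f"
        unfolding eq using 1 by (simp add: Lp_norm_def mult.commute)
    qed
  next
    case (2 q)
    have "(\<integral>\<^sup>+ z. ennreal_powr (ennreal (norm (u z)) * recip_modulus M z) q \<partial>torus2)
        = (\<integral>\<^sup>+ z. ennreal (v z powr q) \<partial>torus2)"
      using v_eq by (intro nn_integral_cong_AE) (auto elim!: eventually_mono simp: ennreal_powr_def v0)
    then have "(\<integral>\<^sup>+ z. ennreal (v z powr q) \<partial>torus2) < \<infinity>"
      using fin 2 by (simp add: power_integral_def)
    then have vi: "integrable torus2 (\<lambda>z. v z powr q)"
      by (intro integrableI_nonneg) auto
    define V where "V = (\<integral>z. v z powr q \<partial>torus2)"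
    have V0: "0 \<le> V" unfolding V_def by (intro integral_nonneg_AE) auto
    \<comment> \<open>Young's inequality with a scale parameter and with the factors \<open>1/p\<close> and \<open>1/q\<close> estimated by \<open>1\<close>.\<close>
    have young: "a * b \<le> t * (a powr p / t powr p + b powr q)" if "0 < t" "0 \<le> a" "0 \<le> b" for a b t :: real
    proof -
      have "(a / t) * b \<le> (a / t) powr p / p + b powr q / q"
        by (rule Youngs_inequality) (use 2 that in auto)
      also have "\<dots> \<le> (a / t) powr p / 1 + b powr q / 1"
        using 2 by (intro add_mono divide_left_mono) auto
      finally have "t * ((a / t) * b) \<le> t * (a powr p / t powr p + b powr q)"
        using that by (intro mult_left_mono) (auto simp: powr_divide)
      then show ?thesis using that by simp
    qed
    show ?thesis
    proof (intro exI[of _ "1 + V"] conjI ballI)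
      show "0 \<le> 1 + V" using V0 by simp
      fix f assume f: "f \<in> Lp_space p"
      then have [measurable]: "f \<in> borel_measurable torus2" by (rule Lp_space_measurable)
      have fi: "integrable torus2 (\<lambda>z. norm (f z) powr p)" using f by (simp add: Lp_space_def)
      have gi: "integrable torus2 (\<lambda>z. t * (norm (f z) powr p / t powr p + v z powr q))" for t
        using fi vi by simp
      show i: "integrable torus2 (\<lambda>z. norm (f z) * norm (u z) / norm (M z))"
        unfolding eq
        by (rule Bochner_Integration.integrable_bound[OF gi[of 1]])
           (measurable, use young[of 1] v0 in auto)
      have *: "(\<integral>z. norm (f z) * v z \<partial>torus2) \<le> (1 + V) * t" if t: "Lp_norm p f \<le> t" "0 < t" for t
      proof -
        have "(\<integral>z. norm (f z) * v z \<partial>torus2) \<le> (\<integral>z. t * (norm (f z) powr p / t powr p + v z powr q) \<partial>torus2)"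
          using i gi[of t] young[of t] t v0 unfolding eq by (intro integral_mono) auto
        also have "\<dots> = t * (Lp_norm p f powr p / t powr p + V)"
          using fi vi p by (simp add: V_def Lp_norm_powr)
        also have "\<dots> \<le> t * (1 + V)"
          using t p by (intro mult_left_mono add_right_mono) (auto simp: divide_le_eq intro!: powr_mono2)
        finally show ?thesis by (simp add: mult.commute)
      qed
      have "(\<lambda>n. (1 + V) * (Lp_norm p f + inverse (real (Suc n)))) \<longlonglongrightarrow> (1 + V) * (Lp_norm p f + 0)"
        by (intro tendsto_intros LIMSEQ_inverse_real_of_nat)
      moreover have "(\<integral>z. norm (f z) * v z \<partial>torus2) \<le> (1 + V) * (Lp_norm p f + inverse (real (Suc n)))" for n
        using Lp_norm_nonneg[of p f] by (intro *) (auto intro!: add_nonneg_pos)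
      ultimately show "(\<integral>z. norm (f z) * norm (u z) / norm (M z) \<partial>torus2) \<le> (1 + V) * Lp_norm p f"
        unfolding eq by (intro LIMSEQ_le_const[where X = "\<lambda>n. (1 + V) * (Lp_norm p f + inverse (real (Suc n)))"]) auto
    qed
  qed
qed

section \<open>Fourier coefficients of trigonometric polynomials\<close>

lemma trig_poly_measurable: "P \<in> trig_poly J \<Longrightarrow> P \<in> borel_measurable torus2"
  by (intro continuous_imp_measurable_torus2 trig_poly_continuous)

lemma character_measurable: "character j \<in> borel_measurable torus2"
  by (intro continuous_imp_measurable_torus2 continuous_on_character)

lemma trig_poly_mult_integrable:
  assumes "P \<in> trig_poly J" "u \<in> borel_measurable torus2" "\<And>z. norm (u z) \<le> U"
  shows "integrable torus2 (\<lambda>z. P z * u z)"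
proof -
  obtain B where "\<And>z. norm (P z) \<le> B" using trig_poly_bounded[OF assms(1)] by blast
  then have "norm (P z * u z) \<le> B * U" for z
    unfolding norm_mult by (intro mult_mono assms(3)) (auto intro: order_trans[OF norm_ge_zero])
  then show ?thesis
    using trig_poly_measurable[OF assms(1)] assms(2) by (intro torus2_integrable_bounded) auto
qed

lemma integral_character_mult:
  "(\<integral>z. character l z * character (- j) z \<partial>torus2) = (if l = j then 4 * pi\<^sup>2 else 0)"
  by (simp add: character_mult integral_character del: add_uminus_conv_diff)
     (auto simp: prod_eq_iff)

lemma trig_poly_coeff_eq_0:
  assumes "P \<in> trig_poly J" "j \<notin> J"
  shows "(\<integral>z. P z * character (- j) z \<partial>torus2) = 0"
proof -
  have "P \<in> trig_poly J \<and> (\<integral>z. P z * character (- j) z \<partial>torus2) = 0"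
    using assms(1) unfolding trig_poly_def
  proof (induction rule: complex_span_induct)
    case (base g)
    then obtain l where "l \<in> J" "g = character l" by auto
    with assms(2) show ?case using base by (auto simp: integral_character_mult complex_span_base)
  next
    case zero
    then show ?case by (simp add: complex_span_eq_span pointwise.span_zero[unfolded zero_fun_def])
  next
    case (add f g)
    then have "integrable torus2 (\<lambda>z. f z * character (- j) z)" "integrable torus2 (\<lambda>z. g z * character (- j) z)"
      by (auto intro!: trig_poly_mult_integrable[where U = 1 and J = J] character_measurable simp: trig_poly_def)
    with add show ?case by (simp add: complex_span_add distrib_right)
  next
    case (scale c f)
    then show ?case by (simp add: complex_span_scale mult.assoc)
  qed
  then show ?thesis ..
qed

text \<open>
  The coefficient \<open>c\<close> is an integral of \<open>P\<close>, hence determined by the function \<open>P\<close>, whereas the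
  representation of an element of a span carries no uniqueness by itself.
\<close>

lemma trig_poly_insert:
  assumes "P \<in> trig_poly (insert j J)" "j \<notin> J"
  obtains c R where "R \<in> trig_poly J" "\<And>z. P z = c * character j z + R z"
    "(\<integral>z. P z * character (- j) z \<partial>torus2) = c * (4 * pi\<^sup>2)"
proof -
  obtain c where c: "(\<lambda>z. P z - c * character j z) \<in> trig_poly J"
    using assms(1) complex_span_insert[of P "character j" "character ` J"]
    by (auto simp: trig_poly_def)
  have P: "integrable torus2 (\<lambda>z. P z * character (- j) z)"
    using assms(1) by (rule trig_poly_mult_integrable[where U = 1]) (auto intro: character_measurable)
  have C: "integrable torus2 (\<lambda>z. c * character j z * character (- j) z)"
    unfolding mult.assoc
    by (intro integrable_mult_right trig_poly_mult_integrable[where U = 1 and J = UNIV] trig_poly_character character_measurable) auto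
  have "(\<integral>z. (P z - c * character j z) * character (- j) z \<partial>torus2) = 0"
    using trig_poly_coeff_eq_0[OF c assms(2)] .
  then have "(\<integral>z. P z * character (- j) z \<partial>torus2) = (\<integral>z. c * character j z * character (- j) z \<partial>torus2)"
    using P C by (simp add: left_diff_distrib)
  also have "\<dots> = c * (4 * pi\<^sup>2)" by (simp add: mult.assoc integral_character_mult)
  finally show thesis using that[OF c, of c] by simp
qed

abbreviation nonzero_frequencies :: "(int \<times> int) set" where
  "nonzero_frequencies \<equiv> UNIV - {(0, 0)}"

lemma trig_poly_split_constant:
  assumes "P \<in> trig_poly UNIV"
  obtains c R where "R \<in> trig_poly nonzero_frequencies" "\<And>z. P z = c + R z"
    "(\<integral>z. P z \<partial>torus2) = c * (4 * pi\<^sup>2)"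
proof -
  have ins: "insert (0, 0) nonzero_frequencies = UNIV" by auto
  have "(0, 0) \<notin> nonzero_frequencies" by simp
  from trig_poly_insert[OF _ this, unfolded ins, OF assms] obtain c R where
    "R \<in> trig_poly nonzero_frequencies" "\<And>z. P z = c * character (0, 0) z + R z"
    "(\<integral>z. P z * character (- (0, 0)) z \<partial>torus2) = c * (4 * pi\<^sup>2)"
    by blast
  then show thesis by (intro that[of R c]) (simp_all add: character_zero)
qed

section \<open>Closed spans of weighted exponentials\<close>

lemma weighted_trig_poly_in_Lp:
  assumes "1 \<le> p" "M \<in> Lp_space p" "P \<in> trig_poly J"
  shows "(\<lambda>z. M z * P z) \<in> Lp_space p"
  using trig_poly_bounded[OF assms(3)] Lp_space_mult_bounded[OF assms(1,2) trig_poly_measurable[OF assms(3)]]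
  by metis

lemma closed_span_iff:
  "f \<in> Lp_closed_span p (weighted_exp M ` J) \<longleftrightarrow>
    f \<in> Lp_space p \<and> (\<forall>\<epsilon>>0. \<exists>P\<in>trig_poly J. Lp_norm p (\<lambda>z. f z - M z * P z) < \<epsilon>)"
  by (simp add: Lp_closed_span_def weighted_span_eq)

text \<open>
  If \<open>P = c e\<^sub>j + R\<close> with \<open>R\<close> in the span over \<open>J\<close> and \<open>c \<noteq> 0\<close>, then \<open>M P = c (M e\<^sub>j - M (- R / c))\<close>, whose norm
  is at least \<open>\<bar>c\<bar>\<close> times the distance of \<open>M e\<^sub>j\<close> from the span. This takes the place of the Hahn-Banach
  theorem.
\<close>

lemma coefficient_bounded_if_not_in_closed_span:
  assumes p: "1 \<le> p" and M: "M \<in> Lp_space p" and j: "j \<notin> J"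
    and notin: "weighted_exp M j \<notin> Lp_closed_span p (weighted_exp M ` J)"
  obtains C where "0 \<le> C"
    "\<And>P. P \<in> trig_poly (insert j J) \<Longrightarrow> norm (\<integral>z. P z * character (- j) z \<partial>torus2) \<le> C * Lp_norm p (\<lambda>z. M z * P z)"
proof -
  obtain \<epsilon> where \<epsilon>: "0 < \<epsilon>" "\<And>P. P \<in> trig_poly J \<Longrightarrow> \<epsilon> \<le> Lp_norm p (\<lambda>z. weighted_exp M j z - M z * P z)"
    using notin weighted_exp_in_Lp_space[OF M, of j] unfolding closed_span_iff by (auto simp: not_less)
  show thesis
  proof (rule that[of "4 * pi\<^sup>2 / \<epsilon>"])
    show "0 \<le> 4 * pi\<^sup>2 / \<epsilon>" using \<epsilon> by simp
    fix P assume P: "P \<in> trig_poly (insert j J)"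
    obtain c R where R: "R \<in> trig_poly J" "\<And>z. P z = c * character j z + R z"
      "(\<integral>z. P z * character (- j) z \<partial>torus2) = c * (4 * pi\<^sup>2)"
      using trig_poly_insert[OF P j] by blast
    show "norm (\<integral>z. P z * character (- j) z \<partial>torus2) \<le> 4 * pi\<^sup>2 / \<epsilon> * Lp_norm p (\<lambda>z. M z * P z)"
    proof (cases "c = 0")
      case True
      then show ?thesis using R(3) \<epsilon> by simp
    next
      case False
      have eq: "(\<lambda>z. M z * P z) = (\<lambda>z. c * (weighted_exp M j z - M z * (- (1 / c) * R z)))"
        using False by (auto simp: fun_eq_iff R(2) weighted_exp_eq[of M] algebra_simps)
      have "norm c * \<epsilon> \<le> norm c * Lp_norm p (\<lambda>z. weighted_exp M j z - M z * (- (1 / c) * R z))"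
        by (intro mult_left_mono \<epsilon>(2) trig_poly_scale R(1)) auto
      also have "\<dots> = Lp_norm p (\<lambda>z. M z * P z)"
        unfolding eq using Lp_norm_scale[OF p] by simp
      finally have "norm c \<le> Lp_norm p (\<lambda>z. M z * P z) / \<epsilon>" using \<epsilon>(1) by (simp add: pos_le_divide_eq)
      then have "norm c * (4 * pi\<^sup>2) \<le> Lp_norm p (\<lambda>z. M z * P z) / \<epsilon> * (4 * pi\<^sup>2)"
        by (intro mult_right_mono) auto
      then show ?thesis unfolding R(3) by (simp add: norm_mult norm_power mult_ac)
    qed
  qed
qed

text \<open>
  The functional \<open>f \<mapsto> \<integral> f u / M\<close> is bounded, vanishes on \<open>M P\<close> for \<open>P\<close> with frequencies in \<open>J\<close>, and
  does not vanish at \<open>M e\<^sub>j\<close>.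
\<close>

lemma not_in_closed_span_if_annihilated:
  assumes p: "1 \<le> p" and M: "M \<in> Lp_space p" and M0: "AE z in torus2. M z \<noteq> 0"
    and u: "u \<in> borel_measurable torus2" "\<And>z. norm (u z) \<le> U" and K: "0 \<le> K"
    and int: "\<And>f. f \<in> Lp_space p \<Longrightarrow> (\<integral>z. norm (f z) * norm (u z) / norm (M z) \<partial>torus2) \<le> K * Lp_norm p f"
    and ann: "\<And>P. P \<in> trig_poly J \<Longrightarrow> (\<integral>z. P z * u z \<partial>torus2) = 0"
    and j: "(\<integral>z. character j z * u z \<partial>torus2) \<noteq> 0"
  shows "weighted_exp M j \<notin> Lp_closed_span p (weighted_exp M ` J)"
proof
  assume "weighted_exp M j \<in> Lp_closed_span p (weighted_exp M ` J)"
  moreover define a where "a = norm (\<integral>z. character j z * u z \<partial>torus2)"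
  moreover have a: "0 < a" using j by (simp add: a_def)
  ultimately obtain P where P: "P \<in> trig_poly J" "Lp_norm p (\<lambda>z. weighted_exp M j z - M z * P z) < a / (K + 1)"
    unfolding closed_span_iff using K by (meson add_nonneg_pos divide_pos_pos zero_less_one)
  define R where "R = (\<lambda>z. character j z - P z)"
  have R: "R \<in> trig_poly UNIV"
    unfolding R_def using P(1) trig_poly_mono[of J UNIV] by (intro trig_poly_diff trig_poly_character) auto
  have MR: "(\<lambda>z. weighted_exp M j z - M z * P z) = (\<lambda>z. M z * R z)"
    by (simp add: R_def weighted_exp_eq[of M] algebra_simps)
  have i: "integrable torus2 (\<lambda>z. character j z * u z)" "integrable torus2 (\<lambda>z. P z * u z)"
    using trig_poly_mult_integrable[OF trig_poly_character[OF UNIV_I] u] trig_poly_mult_integrable[OF P(1) u]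
    by auto
  have "a = norm (\<integral>z. R z * u z \<partial>torus2)"
    using i ann[OF P(1)] by (simp add: a_def R_def left_diff_distrib)
  also have "\<dots> \<le> (\<integral>z. norm (R z * u z) \<partial>torus2)"
    by (rule integral_norm_bound)
  also have "\<dots> = (\<integral>z. norm (M z * R z) * norm (u z) / norm (M z) \<partial>torus2)"
    by (rule integral_cong_AE)
       (use M0 u(1) Lp_space_measurable[OF M] trig_poly_measurable[OF R] in
         \<open>auto elim!: eventually_mono simp: norm_mult\<close>)
  also have "\<dots> \<le> K * Lp_norm p (\<lambda>z. M z * R z)"
    by (intro int weighted_trig_poly_in_Lp[OF p M R])
  also have "\<dots> \<le> K * (a / (K + 1))"
    using P(2) K unfolding MR by (intro mult_left_mono) auto
  also have "\<dots> < a" using K a by (simp add: field_simps)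
  finally show False by simp
qed

text \<open>
  If \<open>M \<noteq> 0\<close> almost everywhere, then \<open>f\<close> is the limit of \<open>M G\<close> for the bounded functions \<open>G\<close> that equal
  \<open>f / M\<close> where \<open>\<bar>f\<bar> \<le> n \<bar>M\<bar>\<close> and \<open>0\<close> elsewhere, and these \<open>G\<close> are bounded limits of trigonometric
  polynomials.
\<close>

lemma weighted_trig_poly_dense:
  assumes p: "1 \<le> p" and M: "M \<in> Lp_space p" and M0: "AE z in torus2. M z \<noteq> 0"
    and f: "f \<in> Lp_space p" and "0 < \<epsilon>"
  obtains P where "P \<in> trig_poly UNIV" "Lp_norm p (\<lambda>z. f z - M z * P z) < \<epsilon>"
proof -
  have [measurable]: "M \<in> borel_measurable torus2" "f \<in> borel_measurable torus2"
    using M f by (auto intro: Lp_space_measurable)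
  \<comment> \<open>Bounded truncations of \<open>f / M\<close>.\<close>
  define G where "G = (\<lambda>n z. if M z \<noteq> 0 \<and> norm (f z) \<le> real n * norm (M z) then f z / M z else 0)"
  have Gm [measurable]: "G n \<in> borel_measurable torus2" for n unfolding G_def by measurable
  have GB: "norm (G n z) \<le> real n" for n z
    by (auto simp: G_def norm_divide divide_le_eq)
  have MG: "norm (M z * G n z) \<le> norm (f z)" for n z by (simp add: G_def)
  have "(\<lambda>n. Lp_norm p (\<lambda>z. f z - M z * G n z)) \<longlonglongrightarrow> 0"
  proof (rule Lp_norm_diff_tendsto_0[OF p])
    show "integrable torus2 (\<lambda>z. norm (f z) powr p)" using f by (simp add: Lp_space_def)
    show "AE z in torus2. (\<lambda>n. M z * G n z) \<longlonglongrightarrow> f z"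
      using M0
    proof eventually_elim
      case (elim z)
      have "eventually (\<lambda>n. M z * G n z = f z) sequentially"
        using eventually_ge_at_top[of "nat \<lceil>norm (f z) / norm (M z)\<rceil>"]
      proof eventually_elim
        case (elim n)
        then have "norm (f z) / norm (M z) \<le> real n" by linarith
        then show ?case using \<open>M z \<noteq> 0\<close> by (simp add: G_def divide_le_eq)
      qed
      then show ?case by (rule tendsto_eventually)
    qed
  qed (use MG in auto)
  then have "eventually (\<lambda>n. Lp_norm p (\<lambda>z. f z - M z * G n z) < \<epsilon> / 8) sequentially"
    using \<open>0 < \<epsilon>\<close> by (intro order_tendstoD) auto
  then obtain n where n: "Lp_norm p (\<lambda>z. f z - M z * G n z) < \<epsilon> / 8"
    unfolding eventually_sequentially by blast
  obtain Q where Q: "\<And>k. Q k \<in> trig_poly UNIV"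
    "\<And>k z. z \<in> space torus2 \<Longrightarrow> norm (Q k z) \<le> real n + 1"
    "AE z in torus2. (\<lambda>k. Q k z) \<longlonglongrightarrow> G n z"
    using bounded_approx_trig_poly[OF Gm GB] by blast
  have [measurable]: "Q k \<in> borel_measurable torus2" for k using Q(1) by (rule trig_poly_measurable)
  have "(\<lambda>k. Lp_norm p (\<lambda>z. M z * G n z - M z * Q k z)) \<longlonglongrightarrow> 0"
  proof (rule Lp_norm_diff_tendsto_0[OF p])
    show "integrable torus2 (\<lambda>z. (norm (M z) * (real n + 1)) powr p)"
      using M by (simp add: powr_mult Lp_space_def)
    show "AE z in torus2. norm (M z * Q k z) \<le> norm (M z) * (real n + 1)" for k
      using Q(2) by (intro AE_I2) (auto simp: norm_mult intro!: mult_left_mono)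
    show "AE z in torus2. (\<lambda>k. M z * Q k z) \<longlonglongrightarrow> M z * G n z"
      using Q(3) by eventually_elim (intro tendsto_intros)
  qed auto
  then have "eventually (\<lambda>k. Lp_norm p (\<lambda>z. M z * G n z - M z * Q k z) < \<epsilon> / 8) sequentially"
    using \<open>0 < \<epsilon>\<close> by (intro order_tendstoD) auto
  then obtain k where k: "Lp_norm p (\<lambda>z. M z * G n z - M z * Q k z) < \<epsilon> / 8"
    unfolding eventually_sequentially by blast
  have MGL: "(\<lambda>z. M z * G n z) \<in> Lp_space p"
    using Lp_space_mult_bounded[OF p M Gm] GB by blast
  have "Lp_norm p (\<lambda>z. (f z - M z * G n z) + (M z * G n z - M z * Q k z))
      \<le> 4 * (Lp_norm p (\<lambda>z. f z - M z * G n z) + Lp_norm p (\<lambda>z. M z * G n z - M z * Q k z))"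
    by (intro Lp_norm_add_le[OF p] Lp_space_diff[OF p] f MGL weighted_trig_poly_in_Lp[OF p M Q(1)])
  also have "\<dots> < \<epsilon>" using n k by simp
  finally show thesis using that[OF Q(1), of k] by simp
qed

section \<open>Completeness\<close>

lemma weighted_exp_zero: "weighted_exp M (0, 0) = M"
  by (simp add: weighted_exp_eq[of M] character_zero)

text \<open>
  If \<open>1/M\<close> were in \<open>L\<^sup>p\<^sup>'\<close>, then \<open>f \<mapsto> \<integral> f / M\<close> would be a bounded functional that annihilates the system
  but not \<open>M\<close>.
\<close>

lemma power_integral_recip_infinite_if_complete:
  assumes p: "1 \<le> p" and p': "1 / ennreal p + 1 / p' = 1" and M: "M \<in> Lp_space p"
    and complete: "Lp_complete_system p nonzero_frequencies (weighted_exp M)"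
  shows "power_integral p' (recip_modulus M) = \<infinity>"
proof (rule ccontr)
  assume "power_integral p' (recip_modulus M) \<noteq> \<infinity>"
  then have fin: "power_integral p' (\<lambda>z. ennreal (norm (1::complex)) * recip_modulus M z) < \<infinity>"
    by (simp add: less_top)
  have Mm: "M \<in> borel_measurable torus2" using M by (rule Lp_space_measurable)
  have M0: "AE z in torus2. M z \<noteq> 0"
    using AE_nonzero_if_finite[OF p p' Mm, of "\<lambda>_. 1", OF _ _ fin] by simp
  obtain K where K: "0 \<le> K"
    "\<And>f. f \<in> Lp_space p \<Longrightarrow> (\<integral>z. norm (f z) * norm (1::complex) / norm (M z) \<partial>torus2) \<le> K * Lp_norm p f"
    using quotient_functional_bounded[OF p p' Mm, of "\<lambda>_. 1", OF borel_measurable_const fin M0] by blast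
  have "weighted_exp M (0, 0) \<notin> Lp_closed_span p (weighted_exp M ` nonzero_frequencies)"
  proof (rule not_in_closed_span_if_annihilated[where u = "\<lambda>_. 1" and U = 1, OF p M M0 _ _ K])
    show "(\<integral>z. P z * 1 \<partial>torus2) = 0" if "P \<in> trig_poly nonzero_frequencies" for P
      using trig_poly_coeff_eq_0[OF that, of "(0,0)"] by (simp add: character_zero)
    show "(\<integral>z. character (0, 0) z * 1 \<partial>torus2) \<noteq> 0"
      by (simp add: integral_character)
  qed auto
  then show False
    using complete M by (simp add: weighted_exp_zero Lp_complete_system_def)
qed

text \<open>
  All products of \<open>M\<close> with trigonometric polynomials are dense, so only the missing frequency \<open>(0, 0)\<close>
  has to be recovered, i.e. \<open>M\<close> itself approximated. If that failed, the mean value of \<open>P\<close> would be bounded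
  by the norm of \<open>M P\<close>, which puts \<open>1/M\<close> into \<open>L\<^sup>p\<^sup>'\<close>.
\<close>

lemma complete_if_power_integral_infinite:
  assumes p: "1 \<le> p" and p': "1 / ennreal p + 1 / p' = 1" and M: "M \<in> Lp_space p"
    and M0: "AE z in torus2. M z \<noteq> 0" and inf: "power_integral p' (recip_modulus M) = \<infinity>"
  shows "Lp_complete_system p nonzero_frequencies (weighted_exp M)"
proof -
  have M_in: "M \<in> Lp_closed_span p (weighted_exp M ` nonzero_frequencies)"
  proof (rule ccontr)
    assume "M \<notin> Lp_closed_span p (weighted_exp M ` nonzero_frequencies)"
    then have notin: "weighted_exp M (0, 0) \<notin> Lp_closed_span p (weighted_exp M ` nonzero_frequencies)"
      by (simp add: weighted_exp_zero)
    have "(0, 0) \<notin> nonzero_frequencies" by simp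
    from coefficient_bounded_if_not_in_closed_span[OF p M this notin]
    obtain C where C: "0 \<le> C"
      "\<And>P. P \<in> trig_poly (insert (0, 0) nonzero_frequencies) \<Longrightarrow>
        norm (\<integral>z. P z * character (- (0, 0)) z \<partial>torus2) \<le> C * Lp_norm p (\<lambda>z. M z * P z)"
      by blast
    have "insert (0, 0) nonzero_frequencies = UNIV" by auto
    then have "norm (\<integral>z. P z * 1 \<partial>torus2) \<le> C * Lp_norm p (\<lambda>z. M z * P z)" if "P \<in> trig_poly UNIV" for P
      using C(2)[of P] that by (simp add: character_zero)
    then have "power_integral p' (\<lambda>z. ennreal (norm (1::complex)) * recip_modulus M z) < \<infinity>"
      by (intro power_integral_finite_if_bound[OF p p' M _ _ C(1), where U = 1]) auto
    with inf show False by simp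
  qed
  have "f \<in> Lp_closed_span p (weighted_exp M ` nonzero_frequencies)" if f: "f \<in> Lp_space p" for f
    unfolding closed_span_iff
  proof (intro conjI f allI impI)
    fix \<epsilon> :: real assume "0 < \<epsilon>"
    obtain P where P: "P \<in> trig_poly UNIV" "Lp_norm p (\<lambda>z. f z - M z * P z) < \<epsilon> / 8"
      using weighted_trig_poly_dense[OF p M M0 f, of "\<epsilon> / 8"] \<open>0 < \<epsilon>\<close> by auto
    obtain c R where R: "R \<in> trig_poly nonzero_frequencies" "\<And>z. P z = c + R z"
      using trig_poly_split_constant[OF P(1)] by blast
    have "0 < \<epsilon> / (8 * (norm c + 1))" using \<open>0 < \<epsilon>\<close> by (auto intro!: divide_pos_pos add_nonneg_pos)
    with M_in obtain S where S: "S \<in> trig_poly nonzero_frequencies"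
      "Lp_norm p (\<lambda>z. M z - M z * S z) < \<epsilon> / (8 * (norm c + 1))"
      unfolding closed_span_iff by blast
    have "norm c * Lp_norm p (\<lambda>z. M z - M z * S z) \<le> (norm c + 1) * (\<epsilon> / (8 * (norm c + 1)))"
      using S(2) by (intro mult_mono) auto
    also have "\<dots> = \<epsilon> / 8" by (simp add: field_simps add_nonneg_eq_0_iff)
    finally have cS: "Lp_norm p (\<lambda>z. c * (M z - M z * S z)) \<le> \<epsilon> / 8"
      by (simp add: Lp_norm_scale[OF p])
    define T where "T = (\<lambda>z. R z + c * S z)"
    have T: "T \<in> trig_poly nonzero_frequencies"
      unfolding T_def by (intro trig_poly_add trig_poly_scale R S)
    have "(\<lambda>z. f z - M z * T z) = (\<lambda>z. (f z - M z * P z) + c * (M z - M z * S z))"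
      by (simp add: T_def R(2) algebra_simps)
    then have "Lp_norm p (\<lambda>z. f z - M z * T z)
        \<le> 4 * (Lp_norm p (\<lambda>z. f z - M z * P z) + Lp_norm p (\<lambda>z. c * (M z - M z * S z)))"
      using Lp_norm_add_le[OF p Lp_space_diff[OF p f weighted_trig_poly_in_Lp[OF p M P(1)]]
          Lp_space_scale[OF p Lp_space_diff[OF p M weighted_trig_poly_in_Lp[OF p M S(1)]], of c]]
      by simp
    also have "\<dots> < \<epsilon>" using P(2) cS by simp
    finally show "\<exists>P\<in>trig_poly nonzero_frequencies. Lp_norm p (\<lambda>z. f z - M z * P z) < \<epsilon>"
      using T by blast
  qed
  then show ?thesis
    unfolding Lp_complete_system_def by (auto simp: Lp_closed_span_def)
qed

section \<open>Minimality\<close>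

lemma integral_character_minus:
  "j \<noteq> (0, 0) \<Longrightarrow> (\<integral>z. character (- j) z \<partial>torus2) = 0"
  by (auto simp: integral_character prod_eq_iff)

lemma character_minus_const_bounds:
  "(\<lambda>z. character j z - d) \<in> borel_measurable torus2" "norm (character j z - d) \<le> 1 + norm d"
  using character_measurable[of j] norm_triangle_ineq4[of "character j z" d] by auto

text \<open>
  Let \<open>\<beta>\<close> be the \<open>j\<close>-th coefficient functional \<open>P \<mapsto> \<integral> P e\<^sub>-\<^sub>j\<close>. Minimality bounds it on polynomials without
  constant term. By completeness there are such polynomials \<open>R\<^sub>n\<close> with \<open>M R\<^sub>n \<longlonglongrightarrow> M\<close> in norm. Applied
  to \<open>P - c (1 - R\<^sub>n)\<close>, where \<open>c\<close> is the constant term of \<open>P\<close>, the bound controls \<open>\<beta> P + c \<beta> R\<^sub>n\<close>. The numbers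
  \<open>\<beta> R\<^sub>n\<close> form a Cauchy sequence by the same bound; with their limit \<open>a\<close>, the control passes to
  \<open>\<beta> P + c a\<close>, which is \<open>\<integral> P (e\<^sub>-\<^sub>j - d)\<close> for \<open>d = - a / (4 \<pi>\<^sup>2)\<close>.
\<close>

lemma shifted_character_bound:
  assumes p: "1 \<le> p" and M: "M \<in> Lp_space p"
    and complete: "Lp_complete_system p nonzero_frequencies (weighted_exp M)"
    and minimal: "Lp_minimal_system p nonzero_frequencies (weighted_exp M)"
    and j: "j \<noteq> (0, 0)"
  obtains C d where "0 \<le> C"
    "\<And>P. P \<in> trig_poly UNIV \<Longrightarrow>
      norm (\<integral>z. P z * (character (- j) z - d) \<partial>torus2) \<le> C * Lp_norm p (\<lambda>z. M z * P z)"
proof -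
  define coeff where "coeff = (\<lambda>P. \<integral>z. P z * character (- j) z \<partial>torus2)"
  have ci: "integrable torus2 (\<lambda>z. P z * character (- j) z)" if "P \<in> trig_poly UNIV" for P
    using that by (rule trig_poly_mult_integrable[where U = 1]) (auto intro: character_measurable)
  have sub: "trig_poly nonzero_frequencies \<subseteq> trig_poly UNIV" by (rule trig_poly_mono) auto
  have coeff_add: "coeff (\<lambda>z. P z + c * Q z) = coeff P + c * coeff Q"
    if "P \<in> trig_poly UNIV" "Q \<in> trig_poly UNIV" for P Q c
    using ci[OF that(1)] ci[OF that(2)] by (simp add: coeff_def distrib_right mult.assoc)
  have ins: "insert j (nonzero_frequencies - {j}) = nonzero_frequencies" using j by auto
  have "weighted_exp M j \<notin> Lp_closed_span p (weighted_exp M ` (nonzero_frequencies - {j}))"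
    using minimal j unfolding Lp_minimal_system_def by blast
  then obtain C where C: "0 \<le> C"
    "\<And>P. P \<in> trig_poly nonzero_frequencies \<Longrightarrow> norm (coeff P) \<le> C * Lp_norm p (\<lambda>z. M z * P z)"
    unfolding coeff_def
    by (rule coefficient_bounded_if_not_in_closed_span[OF p M, of j "nonzero_frequencies - {j}", rotated, unfolded ins])
       simp_all
  have "\<exists>P\<in>trig_poly nonzero_frequencies. Lp_norm p (\<lambda>z. M z - M z * P z) < inverse (real (Suc n))" for n
  proof -
    have "M \<in> Lp_closed_span p (weighted_exp M ` nonzero_frequencies)"
      using complete M by (simp add: Lp_complete_system_def)
    then show ?thesis unfolding closed_span_iff by simp
  qed
  then obtain R where R: "\<And>n. R n \<in> trig_poly nonzero_frequencies"
    "\<And>n. Lp_norm p (\<lambda>z. M z - M z * R n z) < inverse (real (Suc n))" by metis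
  note RL = Lp_space_diff[OF p M weighted_trig_poly_in_Lp[OF p M R(1)]]
  have RU: "R n \<in> trig_poly UNIV" for n using R(1) sub by blast
  have "convergent (\<lambda>n. coeff (R n))"
  proof (rule Cauchy_convergent, rule CauchyI')
    fix e :: real assume "0 < e"
    obtain N where N: "inverse (real (Suc N)) < e / (8 * (C + 1))"
      using reals_Archimedean[of "e / (8 * (C + 1))"] \<open>0 < e\<close> C(1) by auto
    have "norm (coeff (R m) - coeff (R n)) < e" if "N \<le> m" "m < n" for m n
    proof -
      have small: "Lp_norm p (\<lambda>z. M z - M z * R k z) \<le> e / (8 * (C + 1))" if "N \<le> k" for k
      proof -
        have "inverse (real (Suc k)) \<le> inverse (real (Suc N))" using that by (intro le_imp_inverse_le) auto
        then show ?thesis using N R(2)[of k] by linarith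
      qed
      have "coeff (R m) - coeff (R n) = coeff (\<lambda>z. R m z - R n z)"
        using coeff_add[OF RU RU, of m "-1" n] by simp
      then have "norm (coeff (R m) - coeff (R n)) \<le> C * Lp_norm p (\<lambda>z. M z * (R m z - R n z))"
        using C(2)[OF trig_poly_diff[OF R(1) R(1), of m n]] by simp
      also have "(\<lambda>z. M z * (R m z - R n z)) = (\<lambda>z. (M z - M z * R n z) - (M z - M z * R m z))"
        by (simp add: algebra_simps)
      also have "C * Lp_norm p \<dots> \<le> C * (4 * (e / (8 * (C + 1)) + e / (8 * (C + 1))))"
        using Lp_norm_diff_le[OF p RL RL, of n m] small[of m] small[of n] that C(1)
        by (intro mult_left_mono) auto
      also have "\<dots> = C * (8 * (e / (8 * (C + 1))))" by simp
      also have "8 * (e / (8 * (C + 1))) = e / (C + 1)" using C(1) by (simp add: divide_eq_eq add_nonneg_eq_0_iff field_simps)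
      also have "C * (e / (C + 1)) = C / (C + 1) * e" by simp
      also have "\<dots> < 1 * e" using C(1) \<open>0 < e\<close> by (intro mult_strict_right_mono) auto
      finally show ?thesis by simp
    qed
    then show "\<exists>N. \<forall>m\<ge>N. \<forall>n>m. dist (coeff (R m)) (coeff (R n)) < e"
      unfolding dist_norm by blast
  qed
  then obtain a where a: "(\<lambda>n. coeff (R n)) \<longlonglongrightarrow> a" unfolding convergent_def by blast
  define d where "d = - a / (4 * pi\<^sup>2)"
  show thesis
  proof (rule that[of "4 * C" d])
    show "0 \<le> 4 * C" using C(1) by simp
    fix P assume P: "P \<in> trig_poly UNIV"
    obtain c S where S: "S \<in> trig_poly nonzero_frequencies" "\<And>z. P z = c + S z"
      "(\<integral>z. P z \<partial>torus2) = c * (4 * pi\<^sup>2)"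
      using trig_poly_split_constant[OF P] by blast
    have SU: "S \<in> trig_poly UNIV" using S(1) sub by blast
    have Pi: "integrable torus2 P"
      using trig_poly_mult_integrable[OF P, of "\<lambda>_. 1" 1] by simp
    have coeffP: "coeff P = coeff S"
    proof -
      have "P = (\<lambda>z. S z + c * character (0, 0) z)" by (auto simp: S(2) character_zero)
      then have "coeff P = coeff S + c * coeff (character (0, 0))"
        using coeff_add[OF SU trig_poly_character[OF UNIV_I]] by simp
      also have "coeff (character (0, 0)) = 0"
        using integral_character_minus[OF j] by (simp add: coeff_def character_zero)
      finally show ?thesis by simp
    qed
    have bound: "norm (coeff S + c * coeff (R n)) \<le> 4 * C * (Lp_norm p (\<lambda>z. M z * P z) + norm c * inverse (real (Suc n)))" for n
    proof -
      have "(\<lambda>z. S z + c * R n z) \<in> trig_poly nonzero_frequencies"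
        by (rule trig_poly_add[OF S(1) trig_poly_scale[OF R(1)]])
      from C(2)[OF this] have "norm (coeff S + c * coeff (R n)) \<le> C * Lp_norm p (\<lambda>z. M z * (S z + c * R n z))"
        unfolding coeff_add[OF SU RU] .
      also have "(\<lambda>z. M z * (S z + c * R n z)) = (\<lambda>z. M z * P z - c * (M z - M z * R n z))"
        by (simp add: S(2) algebra_simps)
      also have "C * Lp_norm p \<dots> \<le> C * (4 * (Lp_norm p (\<lambda>z. M z * P z) + Lp_norm p (\<lambda>z. c * (M z - M z * R n z))))"
        by (intro mult_left_mono C(1) Lp_norm_diff_le[OF p] Lp_space_scale[OF p] RL weighted_trig_poly_in_Lp[OF p M P])
      also have "\<dots> \<le> C * (4 * (Lp_norm p (\<lambda>z. M z * P z) + norm c * inverse (real (Suc n))))"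
        unfolding Lp_norm_scale[OF p] using R(2)[of n] C(1) by (intro mult_left_mono add_left_mono) auto
      finally show ?thesis by (simp add: mult_ac)
    qed
    have "(\<integral>z. P z * (character (- j) z - d) \<partial>torus2) = coeff P - d * (\<integral>z. P z \<partial>torus2)"
      using ci[OF P] Pi by (simp add: right_diff_distrib coeff_def)
    also have "(\<integral>z. P z \<partial>torus2) = c * (4 * pi\<^sup>2)" by (rule S(3))
    also have "coeff P - d * (c * (4 * pi\<^sup>2)) = coeff S + c * a"
      by (simp add: d_def coeffP)
    finally have eq: "(\<integral>z. P z * (character (- j) z - d) \<partial>torus2) = coeff S + c * a" .
    have "norm (coeff S + c * a) \<le> 4 * C * (Lp_norm p (\<lambda>z. M z * P z) + norm c * 0)"
      by (rule LIMSEQ_le[OF tendsto_norm[OF tendsto_add[OF tendsto_const tendsto_mult[OF tendsto_const a]]]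
            tendsto_mult[OF tendsto_const tendsto_add[OF tendsto_const tendsto_mult[OF tendsto_const LIMSEQ_inverse_real_of_nat]]]])
         (use bound in blast)
    then show "norm (\<integral>z. P z * (character (- j) z - d) \<partial>torus2) \<le> 4 * C * Lp_norm p (\<lambda>z. M z * P z)"
      unfolding eq by simp
  qed
qed

lemma norm_cis_diff: "norm (cis a - cis b) = 2 * \<bar>sin ((a - b) / 2)\<bar>"
proof -
  have "norm (cis a - cis b) = norm (cis b * (cis (a - b) - 1))"
    by (simp add: right_diff_distrib cis_mult)
  also have "\<dots> = norm (exp (\<i> * of_real (a - b)) - 1)"
    by (simp add: norm_mult cis_conv_exp)
  also have "\<dots> = 2 * \<bar>sin ((a - b) / 2)\<bar>" by (rule dist_exp_i_1)
  finally show ?thesis .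
qed

text \<open>
  If \<open>\<bar>d\<bar> \<noteq> 1\<close>, then \<open>\<bar>e\<^sub>-\<^sub>j - d\<bar>\<close> is bounded below and the integrability of \<open>(e\<^sub>-\<^sub>j - d) / M\<close> would put \<open>1/M\<close>
  into \<open>L\<^sup>p\<^sup>'\<close>, contradicting completeness. Stated for a coordinate \<open>t\<close>, to serve \<open>x\<close> and \<open>y\<close> alike.
\<close>

lemma sin_condition_if_complete_minimal:
  assumes p: "1 \<le> p" and p': "1 / ennreal p + 1 / p' = 1" and M: "M \<in> Lp_space p"
    and complete: "Lp_complete_system p nonzero_frequencies (weighted_exp M)"
    and minimal: "Lp_minimal_system p nonzero_frequencies (weighted_exp M)"
    and j: "j \<noteq> (0, 0)" and t: "\<And>z. character (- j) z = cis (- t z)"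
    and tm: "t \<in> borel_measurable torus2"
  shows "\<exists>x0\<in>circle_dom. power_integral p' (\<lambda>z. ennreal \<bar>sin ((t z - x0) / 2)\<bar> * recip_modulus M z) < \<infinity>"
proof -
  have [measurable]: "M \<in> borel_measurable torus2" "t \<in> borel_measurable torus2"
    using M tm by (auto intro: Lp_space_measurable)
  obtain C d where C: "0 \<le> C"
    "\<And>P. P \<in> trig_poly UNIV \<Longrightarrow>
      norm (\<integral>z. P z * (character (- j) z - d) \<partial>torus2) \<le> C * Lp_norm p (\<lambda>z. M z * P z)"
    using shifted_character_bound[OF p M complete minimal j] by blast
  define u where "u = (\<lambda>z. character (- j) z - d)"
  have [measurable]: "u \<in> borel_measurable torus2"
    unfolding u_def by (rule character_minus_const_bounds)
  have fin: "power_integral p' (\<lambda>z. ennreal (norm (u z)) * recip_modulus M z) < \<infinity>"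
    unfolding u_def
    by (rule power_integral_finite_if_bound[OF p p' M character_minus_const_bounds C])
  have "norm d = 1"
  proof (rule ccontr)
    assume "norm d \<noteq> 1"
    define s where "s = \<bar>1 - norm d\<bar>"
    have s: "0 < s" using \<open>norm d \<noteq> 1\<close> by (simp add: s_def)
    have "s \<le> norm (u z)" for z
      using norm_triangle_ineq3[of "character (- j) z" d] by (simp add: s_def u_def)
    then have "recip_modulus M z \<le> ennreal (1 / s) * (ennreal (norm (u z)) * recip_modulus M z)" for z
    proof -
      have "1 \<le> 1 / s * norm (u z)" using s \<open>s \<le> norm (u z)\<close> by (simp add: field_simps)
      then have "1 \<le> ennreal (1 / s) * ennreal (norm (u z))"
        using s by (simp add: ennreal_mult[symmetric] del: ennreal_1 flip: ennreal_1)
      then have "1 * recip_modulus M z \<le> (ennreal (1 / s) * ennreal (norm (u z))) * recip_modulus M z"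
        by (rule mult_right_mono) simp
      then show ?thesis by (simp add: mult.assoc)
    qed
    then have "power_integral p' (recip_modulus M) < \<infinity>"
      by (intro power_integral_finite_mono[OF p p' _ _ _ fin]) auto
    with power_integral_recip_infinite_if_complete[OF p p' M complete] show False by simp
  qed
  \<comment> \<open>The conjugate occurs because \<open>e\<^sub>-\<^sub>j\<close> is \<open>cis (- t)\<close>, so that \<open>d\<close> has to be \<open>cis (- x0)\<close>.\<close>
  define x0 where "x0 = Arg2pi (cnj d)"
  have x0: "x0 \<in> circle_dom" using Arg2pi by (simp add: x0_def circle_dom_def)
  have "cnj d = cis x0"
    using Arg2pi_eq[of "cnj d"] \<open>norm d = 1\<close> by (simp add: x0_def cis_conv_exp)
  then have d: "d = cis (- x0)" by (metis complex_cnj_cnj cis_cnj)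
  have u: "norm (u z) = 2 * \<bar>sin ((t z - x0) / 2)\<bar>" for z
  proof -
    have "(- t z - - x0) / 2 = - ((t z - x0) / 2)" by (simp add: field_simps)
    then show ?thesis unfolding u_def t d norm_cis_diff by (metis abs_minus_cancel sin_minus)
  qed
  have le: "ennreal \<bar>sin ((t z - x0) / 2)\<bar> * recip_modulus M z \<le> ennreal 1 * (ennreal (norm (u z)) * recip_modulus M z)" for z
    unfolding u by (auto intro!: mult_right_mono ennreal_leI)
  have "power_integral p' (\<lambda>z. ennreal \<bar>sin ((t z - x0) / 2)\<bar> * recip_modulus M z) < \<infinity>"
    by (rule power_integral_finite_mono[OF p p' _ _ le fin]) measurable
  with x0 show ?thesis by blast
qed

text \<open>
  \<open>\<bar>v\<^sup>n - w\<^sup>n\<bar> \<le> n \<bar>v - w\<bar>\<close> in the closed unit disc, and conjugation for negative exponents.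
\<close>

lemma norm_cis_of_int_diff_le:
  "norm (cis (of_int k * a) - cis (of_int k * b)) \<le> \<bar>of_int k\<bar> * (2 * \<bar>sin ((a - b) / 2)\<bar>)"
proof -
  have nat: "norm (cis (real n * a) - cis (real n * b)) \<le> real n * (2 * \<bar>sin ((a - b) / 2)\<bar>)" for n
  proof -
    have "norm (cis (real n * a) - cis (real n * b)) \<le> real n * norm (cis a - cis b)"
      unfolding Complex.DeMoivre[symmetric] by (rule norm_power_diff) simp_all
    then show ?thesis by (simp only: norm_cis_diff[of a b])
  qed
  show ?thesis
  proof (cases "0 \<le> k")
    case True
    then show ?thesis using nat[of "nat k"] by simp
  next
    case False
    have "cis (of_int k * a) - cis (of_int k * b) = cnj (cis (real (nat (- k)) * a) - cis (real (nat (- k)) * b))"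
      using False by (simp add: cis_cnj)
    then have "norm (cis (of_int k * a) - cis (of_int k * b)) = norm (cis (real (nat (- k)) * a) - cis (real (nat (- k)) * b))"
      by (simp only: complex_mod_cnj)
    then show ?thesis using nat[of "nat (- k)"] False by simp
  qed
qed

lemma character_cis: "character (k, m) (x, y) = cis (of_int k * x) * cis (of_int m * y)"
  by (simp add: character_altdef cis_conv_exp exp_add distrib_left)

lemma character_diff_le:
  "norm (character (k, m) z - character (k, m) (x0, y0))
    \<le> 2 * \<bar>of_int k\<bar> * \<bar>sin ((fst z - x0) / 2)\<bar> + 2 * \<bar>of_int m\<bar> * \<bar>sin ((snd z - y0) / 2)\<bar>"
proof -
  obtain x y where z: "z = (x, y)" by (cases z)
  have "character (k, m) z - character (k, m) (x0, y0)
      = (cis (of_int k * x) - cis (of_int k * x0)) * cis (of_int m * y)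
        + cis (of_int k * x0) * (cis (of_int m * y) - cis (of_int m * y0))"
    unfolding z character_cis by (simp add: algebra_simps)
  then have "norm (character (k, m) z - character (k, m) (x0, y0))
      \<le> norm (cis (of_int k * x) - cis (of_int k * x0)) + norm (cis (of_int m * y) - cis (of_int m * y0))"
    using norm_triangle_ineq[of "(cis (of_int k * x) - cis (of_int k * x0)) * cis (of_int m * y)"
      "cis (of_int k * x0) * (cis (of_int m * y) - cis (of_int m * y0))"]
    by (simp add: norm_mult)
  also have "\<dots> \<le> \<bar>of_int k\<bar> * (2 * \<bar>sin ((x - x0) / 2)\<bar>) + \<bar>of_int m\<bar> * (2 * \<bar>sin ((y - y0) / 2)\<bar>)"
    by (intro add_mono norm_cis_of_int_diff_le)
  finally show ?thesis by (simp add: z mult_ac)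
qed

lemma AE_torus2_sin_nonzero:
  assumes "x0 \<in> circle_dom"
  shows "AE z in torus2. sin ((fst z - x0) / 2) \<noteq> 0"
proof -
  have "negligible {z::real \<times> real. z \<bullet> (1, 0) = x0}"
    by (rule negligible_standard_hyperplane) (auto simp: Basis_prod_def)
  then have "AE z in lebesgue. z \<notin> {z::real \<times> real. z \<bullet> (1, 0) = x0}"
    unfolding negligible_iff_null_sets by (rule AE_not_in)
  then have "AE z in lebesgue. z \<in> circle_dom \<times> circle_dom \<longrightarrow> sin ((fst z - x0) / 2) \<noteq> 0"
  proof (rule eventually_mono, intro impI)
    fix z :: "real \<times> real"
    assume z: "z \<notin> {z. z \<bullet> (1, 0) = x0}" "z \<in> circle_dom \<times> circle_dom"
    then have "fst z \<noteq> x0" by (cases z) auto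
    moreover have "- (2 * pi) < fst z - x0" "fst z - x0 < 2 * pi"
      using z assms by (auto simp: circle_dom_def)
    ultimately show "sin ((fst z - x0) / 2) \<noteq> 0"
      using sin_gt_zero[of "(fst z - x0) / 2"] sin_gt_zero[of "(x0 - fst z) / 2"]
        sin_minus[of "(fst z - x0) / 2"] by (cases "fst z < x0") (auto simp: minus_divide_left)
  qed
  then show ?thesis
    unfolding torus2_def using torus2_dom_lmeasurable by (subst AE_restrict_space_iff) simp_all
qed

text \<open>
  The functional \<open>f \<mapsto> \<integral> f (e\<^sub>-\<^sub>j - d) / M\<close> with \<open>d = e\<^sub>-\<^sub>j(x\<^sub>0, y\<^sub>0)\<close> is biorthogonal up to a factor: it kills
  \<open>M e\<^sub>l\<close> for \<open>l \<noteq> 0, j\<close> and takes the value \<open>4 \<pi>\<^sup>2\<close> at \<open>M e\<^sub>j\<close>. It is bounded since \<open>e\<^sub>-\<^sub>j\<close>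
  varies, away from \<open>(x\<^sub>0, y\<^sub>0)\<close>, by at most multiples of the two sines.
\<close>

lemma minimal_if_sin_condition:
  assumes p: "1 \<le> p" and p': "1 / ennreal p + 1 / p' = 1" and M: "M \<in> Lp_space p"
    and M0: "AE z in torus2. M z \<noteq> 0"
    and finx: "power_integral p' (\<lambda>z. ennreal \<bar>sin ((fst z - x0) / 2)\<bar> * recip_modulus M z) < \<infinity>"
    and finy: "power_integral p' (\<lambda>z. ennreal \<bar>sin ((snd z - y0) / 2)\<bar> * recip_modulus M z) < \<infinity>"
  shows "Lp_minimal_system p nonzero_frequencies (weighted_exp M)"
proof -
  have Mm [measurable]: "M \<in> borel_measurable torus2" using M by (rule Lp_space_measurable)
  define s1 s2 where "s1 = (\<lambda>z::real \<times> real. complex_of_real (sin ((fst z - x0) / 2)))"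
    and "s2 = (\<lambda>z::real \<times> real. complex_of_real (sin ((snd z - y0) / 2)))"
  have m: "s1 \<in> borel_measurable torus2" "s2 \<in> borel_measurable torus2"
    unfolding s1_def s2_def by (intro continuous_imp_measurable_torus2 continuous_intros; simp)+
  have "power_integral p' (\<lambda>z. ennreal (norm (s1 z)) * recip_modulus M z) < \<infinity>"
    "power_integral p' (\<lambda>z. ennreal (norm (s2 z)) * recip_modulus M z) < \<infinity>"
    using finx finy by (simp_all add: s1_def s2_def)
  from quotient_functional_bounded[OF p p' Mm m(1) this(1) M0]
    quotient_functional_bounded[OF p p' Mm m(2) this(2) M0]
  obtain K1 K2 where K: "0 \<le> K1" "0 \<le> K2"
    and i1: "\<And>f. f \<in> Lp_space p \<Longrightarrow> integrable torus2 (\<lambda>z. norm (f z) * norm (s1 z) / norm (M z))"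
    and i2: "\<And>f. f \<in> Lp_space p \<Longrightarrow> integrable torus2 (\<lambda>z. norm (f z) * norm (s2 z) / norm (M z))"
    and b1: "\<And>f. f \<in> Lp_space p \<Longrightarrow> (\<integral>z. norm (f z) * norm (s1 z) / norm (M z) \<partial>torus2) \<le> K1 * Lp_norm p f"
    and b2: "\<And>f. f \<in> Lp_space p \<Longrightarrow> (\<integral>z. norm (f z) * norm (s2 z) / norm (M z) \<partial>torus2) \<le> K2 * Lp_norm p f"
    by blast
  show ?thesis
    unfolding Lp_minimal_system_def
  proof
    fix j assume "j \<in> nonzero_frequencies"
    then have j: "j \<noteq> (0, 0)" by auto
    obtain k l where kl: "- j = (k, l)" by (cases "- j")
    define d where "d = character (- j) (x0, y0)"
    define A B where "A = 2 * \<bar>real_of_int k\<bar>" and "B = 2 * \<bar>real_of_int l\<bar>"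
    have AB: "0 \<le> A" "0 \<le> B" by (auto simp: A_def B_def)
    define u where "u = (\<lambda>z. character (- j) z - d)"
    have um [measurable]: "u \<in> borel_measurable torus2" unfolding u_def by (rule character_minus_const_bounds)
    have ule: "norm (u z) \<le> A * norm (s1 z) + B * norm (s2 z)" for z
      using character_diff_le[of k l z x0 y0] by (simp add: u_def d_def kl A_def B_def s1_def s2_def)
    show "weighted_exp M j \<notin> Lp_closed_span p (weighted_exp M ` (nonzero_frequencies - {j}))"
    proof (rule not_in_closed_span_if_annihilated[where u = u and U = "1 + norm d" and K = "A * K1 + B * K2", OF p M M0 um])
      show "norm (u z) \<le> 1 + norm d" for z unfolding u_def by (rule character_minus_const_bounds)
      show "0 \<le> A * K1 + B * K2" using AB K by simp
      show "(\<integral>z. norm (f z) * norm (u z) / norm (M z) \<partial>torus2) \<le> (A * K1 + B * K2) * Lp_norm p f"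
        if f: "f \<in> Lp_space p" for f
      proof -
        have [measurable]: "f \<in> borel_measurable torus2" using f by (rule Lp_space_measurable)
        have i: "integrable torus2 (\<lambda>z. A * (norm (f z) * norm (s1 z) / norm (M z)) + B * (norm (f z) * norm (s2 z) / norm (M z)))"
          by (intro Bochner_Integration.integrable_add integrable_mult_right i1 i2 f)
        have le: "norm (f z) * norm (u z) / norm (M z)
            \<le> A * (norm (f z) * norm (s1 z) / norm (M z)) + B * (norm (f z) * norm (s2 z) / norm (M z))" for z
        proof -
          have "norm (f z) * norm (u z) / norm (M z) \<le> norm (f z) * (A * norm (s1 z) + B * norm (s2 z)) / norm (M z)"
            by (intro divide_right_mono mult_left_mono ule) auto
          then show ?thesis by (simp add: distrib_left add_divide_distrib mult_ac)
        qed
        have "integrable torus2 (\<lambda>z. norm (f z) * norm (u z) / norm (M z))"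
        proof (rule Bochner_Integration.integrable_bound[OF i])
          show "AE z in torus2. norm (norm (f z) * norm (u z) / norm (M z))
              \<le> norm (A * (norm (f z) * norm (s1 z) / norm (M z)) + B * (norm (f z) * norm (s2 z) / norm (M z)))"
            using order_trans[OF le abs_ge_self] by (intro AE_I2) (simp del: times_divide_eq_right)
        qed measurable
        then have "(\<integral>z. norm (f z) * norm (u z) / norm (M z) \<partial>torus2)
            \<le> (\<integral>z. A * (norm (f z) * norm (s1 z) / norm (M z)) + B * (norm (f z) * norm (s2 z) / norm (M z)) \<partial>torus2)"
          using i le by (rule integral_mono)
        also have "\<dots> = A * (\<integral>z. norm (f z) * norm (s1 z) / norm (M z) \<partial>torus2) + B * (\<integral>z. norm (f z) * norm (s2 z) / norm (M z) \<partial>torus2)"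
          using i1[OF f] i2[OF f] by (simp del: times_divide_eq_right)
        also have "\<dots> \<le> A * (K1 * Lp_norm p f) + B * (K2 * Lp_norm p f)"
          by (intro add_mono mult_left_mono b1 b2 f AB)
        finally show ?thesis by (simp add: algebra_simps)
      qed
      have ci: "integrable torus2 (\<lambda>z. P z * character (- j) z)" "integrable torus2 P"
        if "P \<in> trig_poly J" for P J
        using trig_poly_mult_integrable[OF that, of "character (- j)" 1]
          trig_poly_mult_integrable[OF that, of "\<lambda>_. 1" 1] by (auto intro: character_measurable)
      show "(\<integral>z. P z * u z \<partial>torus2) = 0" if P: "P \<in> trig_poly (nonzero_frequencies - {j})" for P
        using ci[OF P] trig_poly_coeff_eq_0[OF P, of j] trig_poly_coeff_eq_0[OF P, of "(0, 0)"]
        by (simp add: u_def right_diff_distrib character_zero)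
      show "(\<integral>z. character j z * u z \<partial>torus2) \<noteq> 0"
      proof -
        have "(\<integral>z. character j z * u z \<partial>torus2)
            = (\<integral>z. character j z * character (- j) z \<partial>torus2) - (\<integral>z. character j z \<partial>torus2) * d"
          using ci[OF trig_poly_character[OF UNIV_I], of j] by (simp add: u_def right_diff_distrib)
        also have "\<dots> = 4 * pi\<^sup>2" using j by (simp only: integral_character_mult integral_character if_False) simp
        finally show ?thesis by simp
      qed
    qed
  qed
qed

section \<open>Completeness and minimality together\<close>

theorem theorem4:
  fixes p :: real and p' :: ennreal and M :: "real \<times> real \<Rightarrow> complex"
  assumes "1 \<le> p"
    and "1 / ennreal p + 1 / p' = 1"
    and "M \<in> Lp_space p"
  shows "(Lp_complete_system p (UNIV - {(0, 0)}) (weighted_exp M) \<and>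
          Lp_minimal_system p (UNIV - {(0, 0)}) (weighted_exp M))
     \<longleftrightarrow>
         (power_integral p' (recip_modulus M) = \<infinity> \<and>
          (\<exists>x0\<in>circle_dom. \<exists>y0\<in>circle_dom.
             power_integral p' (\<lambda>(x, y). ennreal \<bar>sin ((x - x0) / 2)\<bar> * recip_modulus M (x, y)) < \<infinity> \<and>
             power_integral p' (\<lambda>(x, y). ennreal \<bar>sin ((y - y0) / 2)\<bar> * recip_modulus M (x, y)) < \<infinity>))"
    (is "?L \<longleftrightarrow> ?R")
proof
  have split: "(\<lambda>(x, y). ennreal \<bar>sin ((x - x0) / 2)\<bar> * recip_modulus M (x, y))
      = (\<lambda>z. ennreal \<bar>sin ((fst z - x0) / 2)\<bar> * recip_modulus M z)"
    "(\<lambda>(x, y). ennreal \<bar>sin ((y - x0) / 2)\<bar> * recip_modulus M (x, y))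
      = (\<lambda>z. ennreal \<bar>sin ((snd z - x0) / 2)\<bar> * recip_modulus M z)" for x0
    by (auto simp: fun_eq_iff)
  note a = assms
  {
    assume ?L
    then have L: "Lp_complete_system p nonzero_frequencies (weighted_exp M)"
      "Lp_minimal_system p nonzero_frequencies (weighted_exp M)" by auto
    have "fst \<in> borel_measurable torus2" "snd \<in> borel_measurable torus2"
      by (intro continuous_imp_measurable_torus2 continuous_intros)+
    then obtain x0 y0 where "x0 \<in> circle_dom" "y0 \<in> circle_dom"
      "power_integral p' (\<lambda>z. ennreal \<bar>sin ((fst z - x0) / 2)\<bar> * recip_modulus M z) < \<infinity>"
      "power_integral p' (\<lambda>z. ennreal \<bar>sin ((snd z - y0) / 2)\<bar> * recip_modulus M z) < \<infinity>"
      using sin_condition_if_complete_minimal[OF a L, of "(1, 0)" fst]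
        sin_condition_if_complete_minimal[OF a L, of "(0, 1)" snd]
      by (auto simp: character_altdef cis_conv_exp)
    then show ?R
      unfolding split using power_integral_recip_infinite_if_complete[OF a L(1)] by blast
  next
    assume ?R
    then obtain x0 y0 where R: "power_integral p' (recip_modulus M) = \<infinity>" "x0 \<in> circle_dom" "y0 \<in> circle_dom"
      "power_integral p' (\<lambda>z. ennreal \<bar>sin ((fst z - x0) / 2)\<bar> * recip_modulus M z) < \<infinity>"
      "power_integral p' (\<lambda>z. ennreal \<bar>sin ((snd z - y0) / 2)\<bar> * recip_modulus M z) < \<infinity>"
      unfolding split by blast
    define s where "s = (\<lambda>z::real \<times> real. complex_of_real (sin ((fst z - x0) / 2)))"
    have sm: "s \<in> borel_measurable torus2"
      unfolding s_def by (intro continuous_imp_measurable_torus2 continuous_intros; simp)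
    have M0: "AE z in torus2. M z \<noteq> 0"
    proof (rule AE_nonzero_if_finite[OF a(1,2) Lp_space_measurable[OF a(3)] sm])
      show "AE z in torus2. s z \<noteq> 0"
        using AE_torus2_sin_nonzero[OF R(2)] by eventually_elim (simp add: s_def)
      show "power_integral p' (\<lambda>z. ennreal (norm (s z)) * recip_modulus M z) < \<infinity>"
        using R(4) by (simp add: s_def)
    qed
    show ?L
      using complete_if_power_integral_infinite[OF a M0 R(1)] minimal_if_sin_condition[OF a M0 R(4,5)] by blast
  }
qed

end
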